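(* For every $n$ there exist an undirected unweighted $n$-node graph $G$ and a pair of nodes $(s,t)$ such that every $2$-FT distance preserver of the single pair $(s,t)$ in $G$ has $\Omega(n^{11/10-o(1)})$ edges.
   Context: A subgraph $H\subseteq G=(V,E)$ is a $2$-FT distance preserver of the pair $(s,t)$ if $\mathrm{dist}_{H\setminus F}(s,t)=\mathrm{dist}_{G\setminus F}(s,t)$ for every edge set $F\subseteq E$ with $|F|\leq 2$. *)

theory Defs
  imports Complex_Main "HOL-Library.Extended_Nat" "HOL-Library.Landau_Symbols"
begin

type_synonym 'a ugraph = "'a set \<times> 'a set set"

abbreviation verts :: "'a ugraph \<Rightarrow> 'a set" where
  "verts G \<equiv> fst G"

abbreviation edges :: "'a ugraph \<Rightarrow> 'a set set" where
  "edges G \<equiv> snd G"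

definition simple_graph :: "'a ugraph \<Rightarrow> bool" where
  "simple_graph G \<longleftrightarrow> finite (verts G) \<and> (\<forall>e \<in> edges G. e \<subseteq> verts G \<and> card e = 2)"

definition subgraph :: "'a ugraph \<Rightarrow> 'a ugraph \<Rightarrow> bool" where
  "subgraph H G \<longleftrightarrow> simple_graph H \<and> verts H \<subseteq> verts G \<and> edges H \<subseteq> edges G"

definition delete_edges :: "'a ugraph \<Rightarrow> 'a set set \<Rightarrow> 'a ugraph" where
  "delete_edges G F = (verts G, edges G - F)"

definition walk_betw :: "'a ugraph \<Rightarrow> 'a \<Rightarrow> 'a list \<Rightarrow> 'a \<Rightarrow> bool" where
  "walk_betw G s p t \<longleftrightarrow>
     p \<noteq> [] \<and> hd p = s \<and> last p = t \<and> set p \<subseteq> verts G \<and>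
     successively (\<lambda>u v. {u, v} \<in> edges G) p"

(* A walk is its list of vertices, so it has one edge fewer than list entries.
   The distance is \<infinity> when there is no walk, in particular if s or t is not a vertex. *)
definition graph_dist :: "'a ugraph \<Rightarrow> 'a \<Rightarrow> 'a \<Rightarrow> enat" where
  "graph_dist G s t = (INF p \<in> {p. walk_betw G s p t}. enat (length p - 1))"

definition two_FT_preserver :: "'a ugraph \<Rightarrow> 'a \<Rightarrow> 'a \<Rightarrow> 'a ugraph \<Rightarrow> bool" where
  "two_FT_preserver G s t H \<longleftrightarrow>
     subgraph H G \<and>
     (\<forall>F. F \<subseteq> edges G \<and> card F \<le> 2 \<longrightarrow>
        graph_dist (delete_edges H F) s t = graph_dist (delete_edges G F) s t)"

end

theory Submission imports Defs "HOL-Library.Product_Plus"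
begin

text \<open>
  An edge \<open>e\<close> is forced if some \<open>F\<close> with \<open>|F| \<le> 2\<close> satisfies
  \<open>dist (G - F) s t < dist (G - F - e) s t\<close>; every preserver contains all forced edges.

  With \<open>D = 8 m\<^sup>2\<close>, take for every \<open>a\<close> in \<open>{0..<D}\<^sup>3\<close> and every level \<open>c \<le> 4 m\<^sup>2\<close> a layered graph
  with \<open>D\<close> steps on points of \<open>\<int>\<^sup>3\<close>, whose steps \<open>u\<close> lie on the paraboloid
  \<open>u\<^sub>1 + u\<^sub>2\<^sup>2 + u\<^sub>3\<^sup>2 = c\<close>. By strict convexity, the straight line is the only \<open>D\<close>-step path from
  \<open>x\<close> to \<open>x + D v\<close> in the level of \<open>v\<close>, and as level \<open>c\<close> is entered at extra cost \<open>c\<close>, lower levels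
  are too low and higher ones too expensive. (The graph is undirected: a backward step gains less than
  \<open>8 m\<^sup>2 \<le> D\<close> in the convex functional but costs two steps.)

  Two families of hubs are attached: the source hub \<open>(a - h, \<alpha>)\<close> to the start \<open>D \<alpha> + h\<close> and the target
  hub \<open>(a + h, \<beta>)\<close> to the end \<open>D \<beta> + h\<close> of the copies \<open>a\<close>, both by paths of length \<open>const + |h|\<^sup>2\<close>.
  A source hub \<open>\<kappa>\<close> and a target hub \<open>\<kappa>'\<close> meet in many copies \<open>a\<close>, but
  \<open>|a - \<kappa>|\<^sup>2 + |\<kappa>' - a|\<^sup>2\<close> is minimal only at the midpoint, which singles out \<open>a\<close> and \<open>h\<close>.
  Finally the hubs hang off a path starting at \<open>s\<close> (resp. \<open>t\<close>), later hubs by sufficiently shorter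
  connections, so that one fault on that path selects the last hub before it. Thus two faults make
  any one of about \<open>m\<^bsup>20\<^esup>\<close> straight lines the unique shortest path. The lines have \<open>D\<close> private edges each,
  hence about \<open>m\<^bsup>22\<^esup>\<close> forced edges, on \<open>O(m\<^bsup>20\<^esup>)\<close> vertices; so even \<open>\<epsilon> = 0\<close> works.

  Optimality of a line is certified by an integer potential that is \<open>D\<close>-Lipschitz on \<open>G - F\<close>, and
  uniqueness by a vertex set \<open>R\<close> containing \<open>s\<close> but not \<open>t\<close> that tight steps can leave only through \<open>e\<close>.
\<close>

section \<open>Forced edges\<close>

lemma walk_betw_mono:
  assumes "walk_betw G s p t" "verts G \<subseteq> verts G'" "edges G \<subseteq> edges G'"
  shows "walk_betw G' s p t"
  using assms unfolding walk_betw_def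
  by (auto intro: successively_mono)

lemma graph_dist_antimono:
  assumes "verts G \<subseteq> verts G'" "edges G \<subseteq> edges G'"
  shows "graph_dist G' s t \<le> graph_dist G s t"
  unfolding graph_dist_def
  by (rule INF_superset_mono) (auto intro: walk_betw_mono[OF _ assms])

lemma graph_dist_le:
  "walk_betw G s p t \<Longrightarrow> graph_dist G s t \<le> enat (length p - 1)"
  unfolding graph_dist_def by (rule INF_lower) simp

lemma less_graph_dist:
  assumes "\<And>p. walk_betw G s p t \<Longrightarrow> n < length p - 1"
  shows "enat n < graph_dist G s t"
proof -
  have "enat (Suc n) \<le> graph_dist G s t"
    unfolding graph_dist_def
    by (rule INF_greatest) (use assms in fastforce)
  then show ?thesis
    by (meson enat_ord_simps(2) lessI less_le_trans)
qed

definition forced_edge :: "'a ugraph \<Rightarrow> 'a \<Rightarrow> 'a \<Rightarrow> 'a set \<Rightarrow> bool" where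
  "forced_edge G s t e \<longleftrightarrow> e \<in> edges G \<and> (\<exists>F \<subseteq> edges G. card F \<le> 2 \<and>
     graph_dist (delete_edges G F) s t < graph_dist (delete_edges G (insert e F)) s t)"

text \<open>If \<open>e\<close> were missing from \<open>H\<close>, then \<open>H\<close> minus
  \<open>F\<close> would lie inside \<open>G\<close> minus \<open>insert e F\<close>, where the
  distance is already too large.\<close>

lemma forced_edge_in_preserver:
  assumes "two_FT_preserver G s t H" "forced_edge G s t e"
  shows "e \<in> edges H"
proof (rule ccontr)
  assume e: "e \<notin> edges H"
  obtain F where F: "F \<subseteq> edges G" "card F \<le> 2"
    "graph_dist (delete_edges G F) s t < graph_dist (delete_edges G (insert e F)) s t"
    using assms(2) unfolding forced_edge_def by blast
  have "graph_dist (delete_edges G (insert e F)) s t \<le> graph_dist (delete_edges H F) s t"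
    by (rule graph_dist_antimono)
      (use assms(1) e in \<open>auto simp: two_FT_preserver_def subgraph_def delete_edges_def\<close>)
  also have "\<dots> = graph_dist (delete_edges G F) s t"
    using assms(1) F unfolding two_FT_preserver_def by blast
  finally show False using F(3) by simp
qed

lemma finite_edges: "simple_graph G \<Longrightarrow> finite (edges G)"
  unfolding simple_graph_def by (meson PowI finite_Pow_iff finite_subset subsetI)

lemma card_forced_le:
  assumes "two_FT_preserver G s t H" "\<And>e. e \<in> C \<Longrightarrow> forced_edge G s t e"
  shows "card C \<le> card (edges H)"
proof (rule card_mono)
  show "finite (edges H)"
    using assms(1) by (intro finite_edges) (simp add: two_FT_preserver_def subgraph_def)
  show "C \<subseteq> edges H"
    using forced_edge_in_preserver[OF assms(1) assms(2)] by blast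
qed

section \<open>Relabelling the vertices and padding with isolated ones\<close>

lemma graph_dist_image:
  assumes inj: "inj_on f V" and E: "\<And>e. e \<in> E \<Longrightarrow> e \<subseteq> V" and V': "f ` V \<subseteq> V'"
    and st: "s \<in> V" "t \<in> V"
  shows "graph_dist (V', (`) f ` E) (f s) (f t) = graph_dist (V, E) s t"
proof (rule antisym)
  show "graph_dist (V', (`) f ` E) (f s) (f t) \<le> graph_dist (V, E) s t"
    unfolding graph_dist_def
  proof (rule INF_greatest)
    fix p assume "p \<in> {p. walk_betw (V, E) s p t}"
    then have p: "walk_betw (V, E) s p t" by simp
    have "successively (\<lambda>u v. {u, v} \<in> (`) f ` E) (map f p)"
      using p unfolding walk_betw_def successively_map
      by (auto elim!: successively_mono intro: image_eqI[where x = "{_, _}"])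
    then have "walk_betw (V', (`) f ` E) (f s) (map f p) (f t)"
      using p V' by (auto simp: walk_betw_def hd_map last_map)
    then show "(INF p\<in>{p. walk_betw (V', (`) f ` E) (f s) p (f t)}. enat (length p - 1))
      \<le> enat (length p - 1)"
      by (intro INF_lower2[of "map f p"]) auto
  qed
  show "graph_dist (V, E) s t \<le> graph_dist (V', (`) f ` E) (f s) (f t)"
    unfolding graph_dist_def
  proof (rule INF_greatest)
    fix p assume "p \<in> {p. walk_betw (V', (`) f ` E) (f s) p (f t)}"
    then have p: "walk_betw (V', (`) f ` E) (f s) p (f t)" by simp
    let ?g = "the_inv_into V f"
    have gf: "?g (f x) = x" if "x \<in> V" for x
      using that inj by (simp add: the_inv_into_f_f)
    have step: "{?g u, ?g v} \<in> E \<and> u \<in> f ` V \<and> v \<in> f ` V" if "{u, v} \<in> (`) f ` E" for u v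
    proof -
      obtain e where e: "e \<in> E" "{u, v} = f ` e" using \<open>{u, v} \<in> (`) f ` E\<close> by blast
      have "?g ` (f ` e) = e"
        using E[OF e(1)] gf by (force simp: image_iff subset_iff)
      then show ?thesis using e E[OF e(1)]
        by (metis image_insert image_empty image_mono insert_subset)
    qed
    have 1: "successively (\<lambda>u v. {?g u, ?g v} \<in> E) p"
    proof (rule successively_mono)
      show "successively (\<lambda>u v. {u, v} \<in> (`) f ` E) p"
        using p by (simp add: walk_betw_def)
    qed (use step in blast)
    have "successively (\<lambda>u v. {u, v} \<in> (`) f ` E) p" "hd p \<in> f ` V" "p \<noteq> []"
      using p st unfolding walk_betw_def by auto
    \<comment> \<open>Further vertices of \<open>V'\<close> are isolated: a walk starting in the
      image of \<open>V\<close> moves along image edges only, so the inverse \<open>?g\<close>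
      applies to all of it.\<close>
    then have "set p \<subseteq> f ` V"
    proof (induction p rule: induct_list012)
      case (3 x y zs)
      then show ?case using step[of x y] by auto
    qed auto
    then have "set (map ?g p) \<subseteq> V" using gf by (auto simp: subset_iff image_iff)
    then have "walk_betw (V, E) s (map ?g p) t"
      using p st gf 1 by (auto simp: walk_betw_def hd_map last_map successively_map)
    then show "(INF p\<in>{p. walk_betw (V, E) s p t}. enat (length p - 1)) \<le> enat (length p - 1)"
      by (intro INF_lower2[of "map ?g p"]) auto
  qed
qed

text \<open>An injection into \<open>{..<n}\<close> carries distances and fault sets over, hence
  also forcedness; numbers outside its image become isolated vertices, which makes the vertex count
  exactly \<open>n\<close>.\<close>

lemma forced_edge_transport:
  fixes G :: "'a ugraph"
  assumes G: "simple_graph G" "card (verts G) \<le> n" "s \<in> verts G" "t \<in> verts G"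
    and forced: "\<And>e. e \<in> C \<Longrightarrow> forced_edge G s t e"
  shows "\<exists>(G' :: nat ugraph) s' t'. simple_graph G' \<and> card (verts G') = n \<and> s' \<in> verts G' \<and>
    t' \<in> verts G' \<and> (\<forall>H. two_FT_preserver G' s' t' H \<longrightarrow> card C \<le> card (edges H))"
proof -
  obtain V E where VE: "G = (V, E)" by force
  have EV: "e \<subseteq> V \<and> card e = 2" if "e \<in> E" for e
    using G(1) that by (auto simp: simple_graph_def VE)
  have "finite V" using G(1) by (simp add: simple_graph_def VE)
  then obtain f :: "'a \<Rightarrow> nat" where f: "inj_on f V" "f ` V \<subseteq> {..<n}"
    using card_le_inj[of V "{..<n}"] G(2) by (auto simp: VE)
  define G' where "G' = ({..<n}, (`) f ` E)"
  have simple: "simple_graph G'"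
    using EV f by (auto simp: simple_graph_def G'_def card_image inj_on_subset dest!: subsetD)
  have injE: "inj_on ((`) f) (Pow V)"
    using f(1) by (rule inj_on_image_Pow)
  have dist: "graph_dist (delete_edges G' ((`) f ` F)) (f s) (f t) = graph_dist (delete_edges G F) s t"
    if "F \<subseteq> E" for F
  proof -
    have "(`) f ` E - (`) f ` F = (`) f ` (E - F)"
      using injE EV that by (intro inj_on_image_set_diff[symmetric, of _ "Pow V"]) auto
    then show ?thesis
      using graph_dist_image[OF f(1), of "E - F" "{..<n}" s t] f(2) EV G(3,4)
      by (auto simp: delete_edges_def G'_def VE)
  qed
  have forced': "forced_edge G' (f s) (f t) (f ` e)" if "e \<in> C" for e
  proof -
    obtain F where F: "F \<subseteq> E" "card F \<le> 2" "e \<in> E"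
      "graph_dist (delete_edges G F) s t < graph_dist (delete_edges G (insert e F)) s t"
      using forced[OF \<open>e \<in> C\<close>] by (auto simp: forced_edge_def VE)
    have "finite F" using F(1) G(1) finite_edges[OF G(1)] finite_subset by (auto simp: VE)
    then have "card ((`) f ` F) \<le> 2" using card_image_le[of F "(`) f"] F(2) by linarith
    then show ?thesis
      using F dist[of F] dist[of "insert e F"] unfolding forced_edge_def
      by (intro conjI exI[of _ "(`) f ` F"]) (auto simp: G'_def)
  qed
  have "C \<subseteq> Pow V" using forced EV by (auto simp: forced_edge_def VE)
  then have "card ((`) f ` C) = card C"
    using injE by (meson card_image inj_on_subset)
  moreover have "card ((`) f ` C) \<le> card (edges H)" if "two_FT_preserver G' (f s) (f t) H" for H
    using that forced' by (intro card_forced_le) auto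
  moreover have "f s < n" "f t < n" using f(2) G(3,4) by (auto simp: VE)
  ultimately show ?thesis
    using simple by (intro exI[of _ G'] exI[of _ "f s"] exI[of _ "f t"]) (auto simp: G'_def)
qed

section \<open>Potentials along walks\<close>

lemma potential_walk:
  fixes \<Psi> :: "'a \<Rightarrow> int"
  assumes lip: "\<And>x y. {x, y} \<in> edges G \<Longrightarrow> \<Psi> y \<le> \<Psi> x + N"
    and closed: "\<And>x y. {x, y} \<in> edges G \<Longrightarrow> x \<in> R \<Longrightarrow> \<Psi> y = \<Psi> x + N \<Longrightarrow> y \<in> R"
    and walk: "walk_betw G s p t"
  shows "\<Psi> t \<le> \<Psi> s + N * int (length p - 1)"
    and "s \<in> R \<Longrightarrow> \<Psi> t = \<Psi> s + N * int (length p - 1) \<Longrightarrow> t \<in> R"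
proof -
  \<comment> \<open>Both claims by one induction: if the total rise is \<open>N\<close> times the
    length, the Lipschitz bound allows no loss on any step, so every step is tight and
    \<open>closed\<close> applies to it.\<close>
  have "successively (\<lambda>u v. {u, v} \<in> edges G) p \<Longrightarrow> p \<noteq> [] \<Longrightarrow>
     \<Psi> (last p) \<le> \<Psi> (hd p) + N * int (length p - 1) \<and>
     (hd p \<in> R \<longrightarrow> \<Psi> (last p) = \<Psi> (hd p) + N * int (length p - 1) \<longrightarrow> last p \<in> R)"
  proof (induction p rule: induct_list012)
    case (3 x y zs)
    then have IH: "\<Psi> (last (y # zs)) \<le> \<Psi> y + N * int (length zs)"
      "y \<in> R \<longrightarrow> \<Psi> (last (y # zs)) = \<Psi> y + N * int (length zs) \<longrightarrow> last (y # zs) \<in> R"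
      and xy: "{x, y} \<in> edges G"
      by auto
    have "\<Psi> y \<le> \<Psi> x + N" "x \<in> R \<Longrightarrow> \<Psi> y = \<Psi> x + N \<Longrightarrow> y \<in> R"
      using lip closed xy by auto
    with IH show ?case by (auto simp: algebra_simps)
  qed auto
  with walk show "\<Psi> t \<le> \<Psi> s + N * int (length p - 1)"
    and "s \<in> R \<Longrightarrow> \<Psi> t = \<Psi> s + N * int (length p - 1) \<Longrightarrow> t \<in> R"
    by (auto simp: walk_betw_def)
qed

section \<open>Subdividing weighted graphs\<close>

definition connected_by :: "'a ugraph \<Rightarrow> nat \<Rightarrow> 'a \<Rightarrow> 'a \<Rightarrow> bool" where
  "connected_by G n x y \<longleftrightarrow> (\<exists>p. walk_betw G x p y \<and> length p = Suc n)"

lemma connected_by_refl: "x \<in> verts G \<Longrightarrow> connected_by G 0 x x"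
  unfolding connected_by_def by (rule exI[of _ "[x]"]) (simp add: walk_betw_def)

lemma connected_by_edge:
  "{x, y} \<in> edges G \<Longrightarrow> x \<in> verts G \<Longrightarrow> y \<in> verts G \<Longrightarrow> connected_by G 1 x y"
  unfolding connected_by_def by (rule exI[of _ "[x, y]"]) (simp add: walk_betw_def)

lemma connected_by_sym: "connected_by G n x y \<Longrightarrow> connected_by G n y x"
  unfolding connected_by_def
proof (elim exE conjE)
  fix p assume "walk_betw G x p y" "length p = Suc n"
  then show "\<exists>p. walk_betw G y p x \<and> length p = Suc n"
    by (intro exI[of _ "rev p"])
      (auto simp: walk_betw_def hd_rev last_rev insert_commute)
qed

lemma connected_by_trans:
  assumes "connected_by G n x y" "connected_by G k y z"
  shows "connected_by G (n + k) x z"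
proof -
  obtain p q where p: "walk_betw G x p y" "length p = Suc n"
    and q: "walk_betw G y q z" "length q = Suc k"
    using assms unfolding connected_by_def by blast
  obtain q' where q': "q = y # q'" using q by (cases q) (auto simp: walk_betw_def)
  have "walk_betw G x (p @ q') z"
    using p q unfolding q' walk_betw_def
    by (cases q') (auto simp: successively_append_iff)
  then show ?thesis
    using p(2) q(2) unfolding connected_by_def q' by (intro exI[of _ "p @ q'"]) simp
qed

datatype 'a subdiv = Orig 'a | Mid 'a 'a nat

definition sub_pos :: "nat \<Rightarrow> 'a \<Rightarrow> 'a \<Rightarrow> nat \<Rightarrow> 'a subdiv" where
  "sub_pos l x y i = (if i = 0 then Orig x else if i = l then Orig y else Mid x y i)"

text \<open>The orientation of the pairs in \<open>E\<close> only serves to number the inner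
  vertices of a subdivided edge; walks use it in both directions.\<close>

definition subdivide :: "'a set \<Rightarrow> ('a \<times> 'a) set \<Rightarrow> ('a \<Rightarrow> 'a \<Rightarrow> nat) \<Rightarrow> 'a subdiv ugraph" where
  "subdivide V E w =
     (Orig ` V \<union> {Mid x y i | x y i. (x, y) \<in> E \<and> 0 < i \<and> i < w x y},
      {{sub_pos (w x y) x y i, sub_pos (w x y) x y (Suc i)} | x y i. (x, y) \<in> E \<and> i < w x y})"

inductive weighted_walk :: "('a \<times> 'a) set \<Rightarrow> ('a \<Rightarrow> 'a \<Rightarrow> nat) \<Rightarrow> nat \<Rightarrow> 'a \<Rightarrow> 'a \<Rightarrow> bool"
  for E w where
  refl: "weighted_walk E w 0 x x"
| fwd: "weighted_walk E w n x y \<Longrightarrow> (y, z) \<in> E \<Longrightarrow> weighted_walk E w (n + w y z) x z"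
| bwd: "weighted_walk E w n x y \<Longrightarrow> (z, y) \<in> E \<Longrightarrow> weighted_walk E w (n + w z y) x z"

lemma weighted_walk_edge: "(x, y) \<in> E \<Longrightarrow> weighted_walk E w (w x y) x y"
  using weighted_walk.fwd[OF weighted_walk.refl] by fastforce

lemma weighted_walk_edge_rev: "(x, y) \<in> E \<Longrightarrow> weighted_walk E w (w x y) y x"
  using weighted_walk.bwd[OF weighted_walk.refl] by fastforce

lemma weighted_walk_trans:
  assumes "weighted_walk E w n x y" "weighted_walk E w k y z"
  shows "weighted_walk E w (n + k) x z"
  using assms(2,1)
  by (induction rule: weighted_walk.induct)
    (auto simp: add.assoc[symmetric] intro: weighted_walk.intros)

lemma weighted_walk_sym: "weighted_walk E w n x y \<Longrightarrow> weighted_walk E w n y x"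
proof (induction rule: weighted_walk.induct)
  case (fwd n x y z)
  then show ?case using weighted_walk_trans[OF weighted_walk_edge_rev fwd.IH] by (simp add: add.commute)
next
  case (bwd n x y z)
  then show ?case using weighted_walk_trans[OF weighted_walk_edge bwd.IH] by (simp add: add.commute)
qed (rule weighted_walk.refl)

locale weighted_graph =
  fixes V :: "'a set" and E :: "('a \<times> 'a) set" and w :: "'a \<Rightarrow> 'a \<Rightarrow> nat"
  assumes finite_V: "finite V"
    and E_subset: "E \<subseteq> V \<times> V"
    and asym: "(x, y) \<in> E \<Longrightarrow> (y, x) \<notin> E"
    and weight_pos: "(x, y) \<in> E \<Longrightarrow> 0 < w x y"
begin

lemma sub_pos_in_verts:
  "(x, y) \<in> E \<Longrightarrow> i \<le> w x y \<Longrightarrow> sub_pos (w x y) x y i \<in> verts (subdivide V E w)"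
  using E_subset by (auto simp: sub_pos_def subdivide_def)

lemma sub_pos_Suc_neq: "(x, y) \<in> E \<Longrightarrow> sub_pos (w x y) x y i \<noteq> sub_pos (w x y) x y (Suc i)"
  using asym[of x y] by (auto simp: sub_pos_def)

lemma simple_subdivide: "simple_graph (subdivide V E w)"
proof -
  have "finite E" using E_subset finite_V finite_subset by blast
  have "{Mid x y i | x y i. (x, y) \<in> E \<and> 0 < i \<and> i < w x y} \<subseteq>
     (\<Union>(x, y)\<in>E. Mid x y ` {..<w x y})" by auto
  then have "finite {Mid x y i | x y i. (x, y) \<in> E \<and> 0 < i \<and> i < w x y}"
    by (rule finite_subset) (use \<open>finite E\<close> in auto)
  then have "finite (verts (subdivide V E w))"
    using finite_V by (simp add: subdivide_def)
  moreover have "e \<subseteq> verts (subdivide V E w) \<and> card e = 2" if e: "e \<in> edges (subdivide V E w)" for e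
  proof -
    obtain x y i where "(x, y) \<in> E" "i < w x y"
      "e = {sub_pos (w x y) x y i, sub_pos (w x y) x y (Suc i)}"
      using e by (auto simp: subdivide_def)
    then show ?thesis
      using sub_pos_in_verts[of x y i] sub_pos_in_verts[of x y "Suc i"] sub_pos_Suc_neq[of x y i]
      by auto
  qed
  ultimately show ?thesis unfolding simple_graph_def by blast
qed

definition unit_edge :: "'a \<times> 'a \<Rightarrow> 'a subdiv set" where
  "unit_edge e = {Orig (fst e), Orig (snd e)}"

lemma unit_edge_in_edges:
  "e \<in> E \<Longrightarrow> w (fst e) (snd e) = 1 \<Longrightarrow> unit_edge e \<in> edges (subdivide V E w)"
  unfolding subdivide_def unit_edge_def
  by (cases e) (force simp: sub_pos_def)

lemma unit_edge_eq:
  assumes xy: "(x, y) \<in> E" "i < w x y"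
    and e: "{sub_pos (w x y) x y i, sub_pos (w x y) x y (Suc i)} = unit_edge e" "e \<in> E"
  shows "e = (x, y)"
  using e asym[of x y] asym[of y x] xy
  by (cases e) (auto simp: unit_edge_def sub_pos_def doubleton_eq_iff split: if_splits)

lemma inj_unit_edge: "inj_on unit_edge E"
proof (rule inj_onI)
  fix e e' assume "e \<in> E" "e' \<in> E" "unit_edge e = unit_edge e'"
  then show "e = e'"
    using asym by (cases e; cases e') (auto simp: unit_edge_def doubleton_eq_iff)
qed

lemma weighted_walk_connected:
  assumes "weighted_walk (E - F) w n x y" "x \<in> V" "F \<subseteq> E"
  shows "connected_by (delete_edges (subdivide V E w) (unit_edge ` F)) n (Orig x) (Orig y)"
proof -
  let ?G = "delete_edges (subdivide V E w) (unit_edge ` F)"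
  have edge: "connected_by ?G (w x y) (Orig x) (Orig y)" if xy: "(x, y) \<in> E - F" for x y
  proof -
    have *: "connected_by ?G i (Orig x) (sub_pos (w x y) x y i)" if "i \<le> w x y" for i
      using that
    proof (induction i)
      case 0
      then show ?case using xy E_subset
        by (auto simp: sub_pos_def subdivide_def delete_edges_def intro!: connected_by_refl)
    next
      case (Suc i)
      have "{sub_pos (w x y) x y i, sub_pos (w x y) x y (Suc i)} \<in> edges ?G"
        using xy Suc.prems unit_edge_eq[of x y i] \<open>F \<subseteq> E\<close>
        by (fastforce simp: delete_edges_def subdivide_def)
      then have "connected_by ?G 1 (sub_pos (w x y) x y i) (sub_pos (w x y) x y (Suc i))"
        using xy Suc.prems sub_pos_in_verts[of x y i] sub_pos_in_verts[of x y "Suc i"]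
        by (intro connected_by_edge) (auto simp: delete_edges_def)
      from connected_by_trans[OF Suc.IH this] show ?case using Suc.prems by simp
    qed
    show ?thesis using *[of "w x y"] weight_pos[of x y] xy by (simp add: sub_pos_def)
  qed
  from assms(1,2) show ?thesis
  proof (induction rule: weighted_walk.induct)
    case (refl x)
    then show ?case by (auto intro!: connected_by_refl simp: delete_edges_def subdivide_def)
  next
    case (fwd n x y z)
    then show ?case by (intro connected_by_trans[OF _ edge]) auto
  next
    case (bwd n x y z)
    then show ?case by (intro connected_by_trans[OF _ connected_by_sym[OF edge]]) auto
  qed
qed

text \<open>
  Along a subdivided edge the potential is extended as the pointwise largest \<open>N\<close>-Lipschitz
  function; it may rise from both ends towards a peak, so a middle vertex joins \<open>R\<close> only if it
  lies on the rising part next to an end in \<open>R\<close>.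
\<close>
lemma forced_unit_edge:
  fixes \<Psi> :: "'a \<Rightarrow> int" and N :: int
  assumes N: "0 < N" and F: "F \<subseteq> E" "card F \<le> 2" "\<And>x y. (x, y) \<in> F \<Longrightarrow> w x y = 1"
    and e: "e \<in> E" "w (fst e) (snd e) = 1"
    and lip: "\<And>x y. (x, y) \<in> E - F \<Longrightarrow> \<bar>\<Psi> x - \<Psi> y\<bar> \<le> N * int (w x y)"
    and up: "\<And>x y. (x, y) \<in> E - F \<Longrightarrow> (x, y) \<noteq> e \<Longrightarrow> x \<in> R \<Longrightarrow> \<Psi> y = \<Psi> x + N * int (w x y) \<Longrightarrow> y \<in> R"
    and down: "\<And>x y. (x, y) \<in> E - F \<Longrightarrow> (x, y) \<noteq> e \<Longrightarrow> y \<in> R \<Longrightarrow> \<Psi> x = \<Psi> y + N * int (w x y) \<Longrightarrow> x \<in> R"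
    and st: "s \<in> V" "s \<in> R" "t \<notin> R"
    and walk: "weighted_walk (E - F) w n s t" "\<Psi> t = \<Psi> s + N * int n"
  shows "forced_edge (subdivide V E w) (Orig s) (Orig t) (unit_edge e)"
proof -
  let ?G = "subdivide V E w"
  let ?F = "unit_edge ` F"
  define val where "val x y i = min (\<Psi> x + N * int i) (\<Psi> y + N * (int (w x y) - int i))" for x y i
  define \<Psi>' where "\<Psi>' v = (case v of Orig x \<Rightarrow> \<Psi> x | Mid x y i \<Rightarrow> val x y i)" for v
  define reach where "reach x y i \<longleftrightarrow> x \<in> R \<and> val x y i = \<Psi> x + N * int i \<or>
    y \<in> R \<and> val x y i = \<Psi> y + N * (int (w x y) - int i)" for x y i
  define R' where "R' = {v. case v of Orig x \<Rightarrow> x \<in> R | Mid x y i \<Rightarrow> reach x y i}"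
  have val: "\<Psi>' (sub_pos (w x y) x y i) = val x y i" if "(x, y) \<in> E - F" for x y i
    using lip[OF that] by (auto simp: \<Psi>'_def sub_pos_def val_def)
  \<comment> \<open>An original end vertex may satisfy \<open>reach\<close> through the opposite
    end. Then the whole edge is tight, and \<open>up\<close> or \<open>down\<close> puts the vertex
    itself into \<open>R\<close>, so both descriptions agree.\<close>
  have reach: "sub_pos (w x y) x y i \<in> R' \<longleftrightarrow> reach x y i" if "(x, y) \<in> E - F" "(x, y) \<noteq> e" for x y i
    using lip[OF that(1)] up[OF that] down[OF that] weight_pos[of x y] that(1)
    by (auto simp: R'_def sub_pos_def reach_def val_def min_def)
  have lip': "\<bar>\<Psi>' v - \<Psi>' u\<bar> \<le> N" if uv: "{u, v} \<in> edges (delete_edges ?G ?F)" for u v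
  proof -
    obtain x y i where *: "(x, y) \<in> E" "i < w x y" "{u, v} \<notin> ?F"
      "{u, v} = {sub_pos (w x y) x y i, sub_pos (w x y) x y (Suc i)}"
      using uv by (auto simp: delete_edges_def subdivide_def)
    \<comment> \<open>Faults have weight 1, so deleting its unit edge removes all of a faulty
      edge.\<close>
    have "(x, y) \<notin> F"
      using *(2-4) F(3)[of x y] by (auto simp: unit_edge_def sub_pos_def image_iff)
    then have "\<bar>val x y (Suc i) - val x y i\<bar> \<le> N" "(x, y) \<in> E - F"
      using N *(1) by (auto simp: val_def min_def algebra_simps)
    then show ?thesis using *(4) by (auto simp: doubleton_eq_iff val)
  qed
  have closed: "v \<in> R'" if uv: "{u, v} \<in> edges (delete_edges ?G (insert (unit_edge e) ?F))"
    and "u \<in> R'" "\<Psi>' v = \<Psi>' u + N" for u v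
  proof -
    have "{u, v} \<in> edges ?G" and uv': "{u, v} \<notin> ?F" "{u, v} \<noteq> unit_edge e"
      using uv by (auto simp: delete_edges_def)
    then obtain x y i where "(x, y) \<in> E" "i < w x y"
      "{u, v} = {sub_pos (w x y) x y i, sub_pos (w x y) x y (Suc i)}"
      unfolding subdivide_def by auto
    note * = this(1,2) uv' this(3)
    have "(x, y) \<notin> F"
      using *(2-5) F(3)[of x y] by (auto simp: unit_edge_def sub_pos_def image_iff)
    moreover have "(x, y) \<noteq> e"
      using *(2-5) e(2) by (auto simp: unit_edge_def sub_pos_def)
    ultimately have E: "(x, y) \<in> E - F" "(x, y) \<noteq> e" using * by auto
    from *(5) consider "u = sub_pos (w x y) x y i" "v = sub_pos (w x y) x y (Suc i)"
      | "v = sub_pos (w x y) x y i" "u = sub_pos (w x y) x y (Suc i)"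
      by (auto simp: doubleton_eq_iff)
    then show ?thesis
    proof cases
      case 1
      then show ?thesis
        using that(2,3) E N by (auto simp: reach val reach_def val_def min_def algebra_simps split: if_splits)
    next
      case 2
      then show ?thesis
        using that(2,3) E N by (auto simp: reach val reach_def val_def min_def algebra_simps split: if_splits)
    qed
  qed
  have "connected_by (delete_edges ?G ?F) n (Orig s) (Orig t)"
    using weighted_walk_connected[OF walk(1) st(1) F(1)] .
  then have "graph_dist (delete_edges ?G ?F) (Orig s) (Orig t) \<le> enat n"
    unfolding connected_by_def using graph_dist_le by fastforce
  also have "enat n < graph_dist (delete_edges ?G (insert (unit_edge e) ?F)) (Orig s) (Orig t)"
  proof (rule less_graph_dist)
    fix p assume p: "walk_betw (delete_edges ?G (insert (unit_edge e) ?F)) (Orig s) p (Orig t)"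
    have lip'': "\<Psi>' y \<le> \<Psi>' x + N"
      if "{x, y} \<in> edges (delete_edges ?G (insert (unit_edge e) ?F))" for x y
      using that lip'[of x y] by (auto simp: delete_edges_def)
    have "\<Psi>' (Orig t) \<le> \<Psi>' (Orig s) + N * int (length p - 1)"
      by (rule potential_walk(1)[OF lip'' closed p])
    moreover have "\<Psi>' (Orig t) \<noteq> \<Psi>' (Orig s) + N * int (length p - 1)"
      using potential_walk(2)[OF lip'' closed p] st by (auto simp: R'_def)
    ultimately have "N * int n < N * int (length p - 1)"
      using walk(2) unfolding \<Psi>'_def by (simp only: subdiv.case)
    then show "n < length p - 1" using N by simp
  qed
  finally have "graph_dist (delete_edges ?G ?F) (Orig s) (Orig t)
    < graph_dist (delete_edges ?G (insert (unit_edge e) ?F)) (Orig s) (Orig t)" .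
  moreover have "?F \<subseteq> edges ?G"
  proof
    fix x assume "x \<in> ?F"
    then obtain a b where "(a, b) \<in> F" "x = unit_edge (a, b)" by auto
    then show "x \<in> edges ?G" using F(1,3) unit_edge_in_edges[of "(a, b)"] by auto
  qed
  moreover have "card ?F \<le> 2"
    using F card_image_le[of F unit_edge] finite_subset[OF E_subset] finite_V
    by (meson finite_SigmaI finite_subset le_trans)
  ultimately show ?thesis
    using unit_edge_in_edges[OF e] unfolding forced_edge_def by blast
qed

end

section \<open>The graph\<close>

type_synonym v3 = "int \<times> int \<times> int"

fun dot :: "v3 \<Rightarrow> v3 \<Rightarrow> int" where
  "dot (a, b, c) (x, y, z) = a * x + b * y + c * z"

fun scale :: "int \<Rightarrow> v3 \<Rightarrow> v3" where
  "scale k (x, y, z) = (k * x, k * y, k * z)"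

lemma dot_add_right: "dot u (x + y) = dot u x + dot u y"
  by (cases u; cases x; cases y) (simp add: algebra_simps)

lemma dot_diff_right: "dot u (x - y) = dot u x - dot u y"
  by (cases u; cases x; cases y) (simp add: algebra_simps)

lemma dot_scale_right: "dot u (scale k x) = k * dot u x"
  by (cases u; cases x) (simp add: algebra_simps)

lemma dot_commute: "dot u x = dot x u"
  by (cases u; cases x) simp

lemma dot_add_left: "dot (x + y) u = dot x u + dot y u"
  using dot_add_right dot_commute by metis

lemma dot_diff_left: "dot (x - y) u = dot x u - dot y u"
  using dot_diff_right dot_commute by metis

lemmas dot_simps = dot_add_right dot_diff_right dot_scale_right dot_add_left dot_diff_left

lemma dot_0_right [simp]: "dot u 0 = 0"
  by (cases u) (simp add: zero_prod_def)

lemma dot_minus [simp]: "dot (- x) (- y) = dot x y"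
  by (cases x; cases y) simp

lemma dot_self_nonneg: "0 \<le> dot u u"
  by (cases u) simp

lemma scale_diff: "scale k x - scale k y = scale k (x - y)"
  by (cases x; cases y) (simp add: algebra_simps)

lemma scale_add: "scale k (x + y) = scale k x + scale k y"
  by (cases x; cases y) (simp add: algebra_simps)

lemma scale_add_left: "scale (k + l) x = scale k x + scale l x"
  by (cases x) (simp add: algebra_simps)

lemma scale_0 [simp]: "scale 0 x = 0"
  by (cases x) (simp add: zero_prod_def)

lemma scale_1 [simp]: "scale 1 x = x"
  by (cases x) simp

definition box3 :: "int \<Rightarrow> int \<Rightarrow> int \<Rightarrow> v3 set" where
  "box3 a b c = {0..<a} \<times> {0..<b} \<times> {0..<c}"

text \<open>Division with remainder by \<open>n\<close> in each coordinate. A grid point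
  \<open>scale D \<alpha> + h\<close> thus encodes both \<alpha> and \<open>h\<close>.\<close>

lemma scale_add_box_inj:
  assumes "scale n x + h = scale n y + k" "h \<in> box3 n n n" "k \<in> box3 n n n"
  shows "x = y \<and> h = k"
proof -
  have *: "i = j \<and> r = s"
    if "n * i + r = n * j + s" "0 \<le> r" "r < n" "0 \<le> s" "s < n" for i j r s :: int
  proof -
    have "n \<noteq> 0" "r div n = 0" "s div n = 0" using that by (auto simp: div_pos_pos_trivial)
    then have "(n * i + r) div n = i" "(n * j + s) div n = j" by simp_all
    then show ?thesis using that(1) by simp
  qed
  show ?thesis using assms
    by (cases x; cases y; cases h; cases k) (auto simp: box3_def dest!: *)
qed

text \<open>
  The \<^typ>\<open>bool\<close> tells the source side (\<^const>\<open>False\<close>) from the target side. \<open>Grid a c k z\<close> is the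
  point \<open>z\<close> in layer \<open>k\<close> of level \<open>c\<close> of copy \<open>a\<close>; in the last layer \<open>k = D\<close> the levels are merged
  and only \<open>c = 0\<close> is used.
\<close>
datatype node = Path bool int | Hub bool v3 v3 | Grid v3 int int v3

section \<open>Parameters, edges and weights\<close>

locale parameters =
  fixes m :: int and idx :: "v3 \<Rightarrow> int" and jdx :: "int \<times> int \<Rightarrow> int"
  assumes m_pos: "1 \<le> m"
begin

definition D :: int where "D = 8 * m\<^sup>2"
text \<open>Hub positions: the range contains \<open>a - h\<close> and \<open>a + h\<close> for all
  \<open>a\<close> and \<open>h\<close> in \<open>box3 D D D\<close>.\<close>

definition K :: "v3 set" where "K = {- D..<2 * D} \<times> {- D..<2 * D} \<times> {- D..<2 * D}"
definition A :: "v3 set" where "A = box3 (2 * m\<^sup>2) m m"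
definition Z :: "v3 set" where "Z = box3 (2 * D * m\<^sup>2) (D * m) (D * m)"
definition step :: "int \<Rightarrow> int \<Rightarrow> int \<Rightarrow> v3" where "step c y z = (c - y\<^sup>2 - z\<^sup>2, y, z)"
text \<open>Room for a stride of \<open>12 * D\<^sup>2\<close> for each of the
  \<open>27 * D ^ 3\<close> values of \<open>idx\<close>. With \<open>base = 4 * len\<close> every
  hook weighs more than \<open>2 * len\<close>.\<close>

definition len :: int where "len = 324 * D ^ 5"
definition base :: int where "base = 4 * len"
text \<open>The offset in the potential of hubs at a wrong position. It dominates
  \<open>dot h h + 2 * dot h (b - a)\<close>, at most \<open>9 * D\<^sup>2\<close>, plus lower
  terms, and equals the slot gap \<open>12 * D\<^sup>2 - 2 * D\<^sup>2\<close>. The larger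
  \<open>link\<close> keeps links from being tight backwards.\<close>

definition excess :: int where "excess = 10 * D\<^sup>2"
definition link :: int where "link = 20 * D\<^sup>2"

text \<open>
  The position of a hub on its path. The strides exceed the possible variation of the distances
  between hubs, so that the hook weights \<open>base - 2 * slot\<close> order the hubs lexicographically.
\<close>
fun slot :: "v3 \<Rightarrow> v3 \<Rightarrow> int" where
  "slot \<kappa> (x, yz) = 12 * D\<^sup>2 * idx \<kappa> + 12 * m\<^sup>2 * jdx yz + 2 * x"

inductive_set E :: "(node \<times> node) set" where
  path: "0 \<le> i \<Longrightarrow> i < len \<Longrightarrow> (Path b i, Path b (i + 1)) \<in> E"
| hook: "\<kappa> \<in> K \<Longrightarrow> \<alpha> \<in> A \<Longrightarrow> (Path b (slot \<kappa> \<alpha>), Hub b \<kappa> \<alpha>) \<in> E"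
| source: "\<kappa> \<in> K \<Longrightarrow> \<alpha> \<in> A \<Longrightarrow> a \<in> box3 D D D \<Longrightarrow> a - \<kappa> \<in> box3 D D D \<Longrightarrow>
    (Hub False \<kappa> \<alpha>, Grid a 0 0 (scale D \<alpha> + (a - \<kappa>))) \<in> E"
| target: "\<kappa> \<in> K \<Longrightarrow> \<alpha> \<in> A \<Longrightarrow> a \<in> box3 D D D \<Longrightarrow> \<kappa> - a \<in> box3 D D D \<Longrightarrow>
    (Hub True \<kappa> \<alpha>, Grid a 0 D (scale D \<alpha> + (\<kappa> - a))) \<in> E"
| bus: "a \<in> box3 D D D \<Longrightarrow> 0 \<le> c \<Longrightarrow> c < 4 * m\<^sup>2 \<Longrightarrow> z \<in> Z \<Longrightarrow> (Grid a c 0 z, Grid a (c + 1) 0 z) \<in> E"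
| step: "a \<in> box3 D D D \<Longrightarrow> 0 \<le> c \<Longrightarrow> c \<le> 4 * m\<^sup>2 \<Longrightarrow> 0 \<le> k \<Longrightarrow> k < D \<Longrightarrow> z \<in> Z \<Longrightarrow>
    \<bar>x\<bar> < m \<Longrightarrow> \<bar>y\<bar> < m \<Longrightarrow> z + step c x y \<in> Z \<Longrightarrow>
    (Grid a c k z, Grid a (if k + 1 = D then 0 else c) (k + 1) (z + step c x y)) \<in> E"

text \<open>A hub with slot \<open>i\<close> is reached from the start of its path at cost
  \<open>i + (base - 2 * i) = base - i\<close>, so later hubs are nearer. The squared link lengths
  are strictly convex in \<open>a\<close>, which favours the midpoint copy.\<close>

fun weight :: "node \<Rightarrow> node \<Rightarrow> nat" where
  "weight (Path _ i) (Hub _ _ _) = nat (base - 2 * i)"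
| "weight (Hub _ \<kappa> _) (Grid a _ _ _) = nat (link + dot (a - \<kappa>) (a - \<kappa>))"
| "weight _ _ = 1"

definition V :: "node set" where
  "V = (\<Union>b. Path b ` {0..len}) \<union> (\<Union>b. (\<lambda>(\<kappa>, \<alpha>). Hub b \<kappa> \<alpha>) ` (K \<times> A)) \<union>
     (\<lambda>(a, c, k, z). Grid a c k z) ` (box3 D D D \<times> {0..4 * m\<^sup>2} \<times> {0..D} \<times> Z)"

lemma D_pos: "8 \<le> D" "8 * m \<le> D" "8 * m\<^sup>2 \<le> D" "8 * D \<le> D\<^sup>2"
proof -
  have "1 \<le> m\<^sup>2" "m \<le> m\<^sup>2" using m_pos self_le_power[of m 2] by simp_all
  then show "8 \<le> D" "8 * m \<le> D" "8 * m\<^sup>2 \<le> D" by (simp_all add: D_def)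
  then show "8 * D \<le> D\<^sup>2" by (simp add: power2_eq_square)
qed

lemma dot_box_bounds:
  assumes "x \<in> box3 D D D" "y \<in> box3 D D D"
  shows "0 \<le> dot x y" "dot x y \<le> 3 * D\<^sup>2"
proof -
  obtain x1 x2 x3 where x: "x = (x1, x2, x3)" by (cases x)
  obtain y1 y2 y3 where y: "y = (y1, y2, y3)" by (cases y)
  have *: "0 \<le> i * j \<and> i * j \<le> D * D" if "i \<in> {0..<D}" "j \<in> {0..<D}" for i j
    using that by (auto intro: mult_mono)
  have "x1 \<in> {0..<D}" "x2 \<in> {0..<D}" "x3 \<in> {0..<D}" "y1 \<in> {0..<D}" "y2 \<in> {0..<D}" "y3 \<in> {0..<D}"
    using assms by (simp_all add: x y box3_def)
  then have "0 \<le> x1 * y1 \<and> x1 * y1 \<le> D * D" "0 \<le> x2 * y2 \<and> x2 * y2 \<le> D * D"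
    "0 \<le> x3 * y3 \<and> x3 * y3 \<le> D * D"
    using * by blast+
  then show "0 \<le> dot x y" "dot x y \<le> 3 * D\<^sup>2"
    unfolding x y dot.simps power2_eq_square by linarith+
qed

end

locale construction = parameters +
  assumes idx: "inj_on idx K" "\<And>\<kappa>. \<kappa> \<in> K \<Longrightarrow> 0 \<le> idx \<kappa>" "\<And>\<kappa>. \<kappa> \<in> K \<Longrightarrow> idx \<kappa> < 27 * D ^ 3"
    and jdx: "inj_on jdx ({0..<m} \<times> {0..<m})"
      "\<And>p. p \<in> {0..<m} \<times> {0..<m} \<Longrightarrow> 0 \<le> jdx p" "\<And>p. p \<in> {0..<m} \<times> {0..<m} \<Longrightarrow> jdx p < m\<^sup>2"
begin

section \<open>Order and gaps of the hub slots\<close>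

lemma slot_inner:
  assumes "(x, yz) \<in> A"
  shows "0 \<le> 12 * m\<^sup>2 * jdx yz + 2 * x" "12 * m\<^sup>2 * jdx yz + 2 * x < 2 * D\<^sup>2"
proof -
  have A: "0 \<le> x" "x < 2 * m\<^sup>2" "yz \<in> {0..<m} \<times> {0..<m}" using assms by (auto simp: A_def box3_def)
  then show "0 \<le> 12 * m\<^sup>2 * jdx yz + 2 * x" using jdx(2)[of yz] by simp
  have "12 * m\<^sup>2 * (jdx yz + 1) \<le> 12 * m\<^sup>2 * m\<^sup>2"
    using jdx(3)[OF A(3)] by (intro mult_left_mono) auto
  then have "12 * m\<^sup>2 * jdx yz + 2 * x < 12 * m\<^sup>2 * m\<^sup>2" using A by (simp add: algebra_simps)
  also have "\<dots> \<le> 2 * D\<^sup>2" using m_pos by (simp add: D_def power2_eq_square)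
  finally show "12 * m\<^sup>2 * jdx yz + 2 * x < 2 * D\<^sup>2" .
qed

lemma slot_bounds:
  assumes "\<kappa> \<in> K" "\<alpha> \<in> A"
  shows "0 \<le> slot \<kappa> \<alpha>" "slot \<kappa> \<alpha> < len"
proof -
  obtain x yz where \<alpha>: "\<alpha> = (x, yz)" by (cases \<alpha>)
  note s = slot_inner[of x yz, OF assms(2)[unfolded \<alpha>]]
  have "12 * D\<^sup>2 * (idx \<kappa> + 1) \<le> 12 * D\<^sup>2 * (27 * D ^ 3)"
    using idx(3)[OF assms(1)] by (intro mult_left_mono) auto
  then have "12 * D\<^sup>2 * idx \<kappa> + 12 * D\<^sup>2 \<le> len"
    by (simp add: len_def algebra_simps power2_eq_square power3_eq_cube numeral_eq_Suc)
  moreover have "0 \<le> 12 * D\<^sup>2 * idx \<kappa>" using idx(2)[OF assms(1)] by simp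
  ultimately show "0 \<le> slot \<kappa> \<alpha>" "slot \<kappa> \<alpha> < len"
    using s D_pos unfolding \<alpha> slot.simps by linarith+
qed

text \<open>The stride \<open>12 * D\<^sup>2\<close> of \<open>idx\<close> outweighs the remaining
  terms, which range over less than \<open>2 * D\<^sup>2\<close>; the difference is
  \<open>excess\<close>.\<close>

lemma slot_gap_K:
  assumes "\<kappa> \<in> K" "\<kappa>' \<in> K" "\<alpha> \<in> A" "\<alpha>' \<in> A" "\<kappa> \<noteq> \<kappa>'" "slot \<kappa> \<alpha> \<le> slot \<kappa>' \<alpha>'"
  shows "slot \<kappa> \<alpha> + excess < slot \<kappa>' \<alpha>'"
proof -
  obtain x yz x' yz' where \<alpha>: "\<alpha> = (x, yz)" "\<alpha>' = (x', yz')" by (cases \<alpha>; cases \<alpha>')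
  note s = slot_inner[of x yz] slot_inner[of x' yz']
  have "idx \<kappa> \<noteq> idx \<kappa>'" using assms idx(1) by (auto dest: inj_onD)
  moreover have "\<not> idx \<kappa>' < idx \<kappa>"
  proof
    assume "idx \<kappa>' < idx \<kappa>"
    then have "12 * D\<^sup>2 * (idx \<kappa>' + 1) \<le> 12 * D\<^sup>2 * idx \<kappa>" by (intro mult_left_mono) auto
    then have "12 * D\<^sup>2 * idx \<kappa>' + 12 * D\<^sup>2 \<le> 12 * D\<^sup>2 * idx \<kappa>" by (simp add: algebra_simps)
    then show False using assms s D_pos unfolding \<alpha> by simp
  qed
  ultimately have "12 * D\<^sup>2 * (idx \<kappa> + 1) \<le> 12 * D\<^sup>2 * idx \<kappa>'" by (intro mult_left_mono) auto
  then have "12 * D\<^sup>2 * idx \<kappa> + 12 * D\<^sup>2 \<le> 12 * D\<^sup>2 * idx \<kappa>'" by (simp add: algebra_simps)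
  then show ?thesis using assms s unfolding \<alpha> excess_def by simp
qed

text \<open>If the last two coordinates agree, the slots differ by twice the difference in the first
  one, which the functional counts once. Otherwise the slots are more than
  \<open>12 * m\<^sup>2 - 4 * m\<^sup>2\<close> apart, while the functional varies by less than
  \<open>6 * m\<^sup>2\<close>.\<close>

lemma slot_gap_A:
  assumes "\<alpha> \<in> A" "\<alpha>' \<in> A" "\<alpha> \<noteq> \<alpha>'" "slot \<kappa> \<alpha> \<le> slot \<kappa> \<alpha>'" "\<bar>p\<bar> < m" "\<bar>q\<bar> < m"
  shows "\<bar>dot (1, 2 * p, 2 * q) (\<alpha> - \<alpha>')\<bar> < slot \<kappa> \<alpha>' - slot \<kappa> \<alpha>"
proof -
  obtain x y z where "\<alpha> = (x, y, z)" by (cases \<alpha>)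
  moreover obtain x' y' z' where "\<alpha>' = (x', y', z')" by (cases \<alpha>')
  ultimately have \<alpha>: "\<alpha> = (x, y, z)" "\<alpha>' = (x', y', z')" by auto
  have A: "0 \<le> x" "x < 2 * m\<^sup>2" "0 \<le> x'" "x' < 2 * m\<^sup>2" "0 \<le> y" "y < m" "0 \<le> z" "z < m"
    "0 \<le> y'" "y' < m" "0 \<le> z'" "z' < m"
    using assms by (auto simp: A_def box3_def \<alpha>)
  show ?thesis
  proof (cases "(y, z) = (y', z')")
    case True
    then show ?thesis using assms by (auto simp: \<alpha> zero_prod_def)
  next
    case False
    then have neq: "jdx (y, z) \<noteq> jdx (y', z')"
      using A by (intro inj_on_contraD[OF jdx(1)]) auto
    have "\<not> jdx (y', z') < jdx (y, z)"
    proof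
      assume "jdx (y', z') < jdx (y, z)"
      then have "12 * m\<^sup>2 * (jdx (y', z') + 1) \<le> 12 * m\<^sup>2 * jdx (y, z)" by (intro mult_left_mono) auto
      then have "12 * m\<^sup>2 * jdx (y', z') + 12 * m\<^sup>2 \<le> 12 * m\<^sup>2 * jdx (y, z)" by (simp add: algebra_simps)
      moreover have "12 * m\<^sup>2 * jdx (y, z) + 2 * x \<le> 12 * m\<^sup>2 * jdx (y', z') + 2 * x'"
        using assms(4) by (simp add: \<alpha>)
      ultimately show False using A by linarith
    qed
    then have "12 * m\<^sup>2 * (jdx (y, z) + 1) \<le> 12 * m\<^sup>2 * jdx (y', z')"
      using neq by (intro mult_left_mono) auto
    then have "12 * m\<^sup>2 * jdx (y, z) + 12 * m\<^sup>2 \<le> 12 * m\<^sup>2 * jdx (y', z')" by (simp add: algebra_simps)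
    then have "8 * m\<^sup>2 < slot \<kappa> \<alpha>' - slot \<kappa> \<alpha>" using A by (simp add: \<alpha>)
    moreover have "\<bar>2 * p * (y - y')\<bar> \<le> 2 * m\<^sup>2" "\<bar>2 * q * (z - z')\<bar> \<le> 2 * m\<^sup>2"
    proof -
      have "\<bar>p * (y - y')\<bar> \<le> m * m" "\<bar>q * (z - z')\<bar> \<le> m * m"
        unfolding abs_mult using A assms(5,6) by (auto intro!: mult_mono)
      then show "\<bar>2 * p * (y - y')\<bar> \<le> 2 * m\<^sup>2" "\<bar>2 * q * (z - z')\<bar> \<le> 2 * m\<^sup>2"
        by (auto simp: power2_eq_square abs_mult)
    qed
    moreover have "\<bar>x - x'\<bar> < 2 * m\<^sup>2" using A by auto
    ultimately show ?thesis unfolding \<alpha> by simp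
  qed
qed

lemma slot_inj:
  assumes "\<kappa> \<in> K" "\<kappa>' \<in> K" "\<alpha> \<in> A" "\<alpha>' \<in> A" "slot \<kappa> \<alpha> = slot \<kappa>' \<alpha>'"
  shows "\<kappa> = \<kappa>' \<and> \<alpha> = \<alpha>'"
proof -
  have "\<kappa> = \<kappa>'"
  proof (rule ccontr)
    assume "\<kappa> \<noteq> \<kappa>'"
    then show False using slot_gap_K[OF assms(1-4)] assms(5) D_pos by (simp add: excess_def)
  qed
  moreover have "\<alpha> = \<alpha>'"
    using slot_gap_A[OF assms(3,4), of \<kappa> 0 0] assms(5) m_pos \<open>\<kappa> = \<kappa>'\<close> by auto
  ultimately show ?thesis by simp
qed

lemma scale_A_add_in_Z:
  assumes "\<alpha> \<in> A" "h \<in> box3 D D D"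
  shows "scale D \<alpha> + h \<in> Z"
proof -
  obtain x y z where \<alpha>: "\<alpha> = (x, y, z)" by (cases \<alpha>)
  obtain h1 h2 h3 where h: "h = (h1, h2, h3)" by (cases h)
  have b: "0 \<le> D * i + j \<and> D * i + j < D * n" if "0 \<le> i" "i < n" "0 \<le> j" "j < D" for i j n
  proof -
    have "D * (i + 1) \<le> D * n" using that D_pos by (intro mult_left_mono) auto
    then show ?thesis using that D_pos by (simp add: algebra_simps)
  qed
  show ?thesis
    using assms b[of x "2 * m\<^sup>2" h1] b[of y m h2] b[of z m h3]
    by (simp add: \<alpha> h A_def Z_def box3_def algebra_simps)
qed

section \<open>Well-formedness of the weighted graph\<close>

lemma E_subset: "E \<subseteq> V \<times> V"
proof safe
  fix x y assume "(x, y) \<in> E"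
  have gV: "Grid a c k z \<in> V" if "a \<in> box3 D D D" "0 \<le> c" "c \<le> 4 * m\<^sup>2" "0 \<le> k" "k \<le> D" "z \<in> Z" for a c k z
    unfolding V_def using that by (intro UnI2 image_eqI[of _ _ "(a, c, k, z)"]) simp_all
  have hV: "Hub b \<kappa> \<alpha> \<in> V" if "\<kappa> \<in> K" "\<alpha> \<in> A" for b \<kappa> \<alpha>
    unfolding V_def using that by (intro UnI1 UnI2 UN_I[of b] image_eqI[of _ _ "(\<kappa>, \<alpha>)"]) simp_all
  have pV: "Path b i \<in> V" if "0 \<le> i" "i \<le> len" for b i
    unfolding V_def using that by (intro UnI1 UN_I[of b]) simp_all
  from \<open>(x, y) \<in> E\<close> have "x \<in> V \<and> y \<in> V"
  proof cases
    case (path i b)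
    then show ?thesis by (simp add: pV)
  next
    case (hook \<kappa> \<alpha> b)
    then show ?thesis using slot_bounds[of \<kappa> \<alpha>] by (simp add: pV hV)
  next
    case (source \<kappa> \<alpha> a)
    then show ?thesis using D_pos m_pos by (simp add: hV gV scale_A_add_in_Z)
  next
    case (target \<kappa> \<alpha> a)
    then show ?thesis using D_pos m_pos by (simp add: hV gV scale_A_add_in_Z)
  next
    case (bus a c z)
    then show ?thesis using D_pos by (simp add: gV)
  next
    case (step a c k z x y)
    then show ?thesis using D_pos by (simp add: gV)
  qed
  then show "x \<in> V" "y \<in> V" by auto
qed

lemma finite_V: "finite V"
  by (auto simp: V_def box3_def K_def A_def Z_def)

lemma weight_pos: "(x, y) \<in> E \<Longrightarrow> 0 < weight x y"
proof (induction rule: E.cases)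
  case (hook \<kappa> \<alpha> b)
  then show ?case using slot_bounds[of \<kappa> \<alpha>] by (simp add: base_def)
next
  case (source \<kappa> \<alpha> a)
  then show ?case using dot_self_nonneg[of "a - \<kappa>"] D_pos by (simp add: link_def)
next
  case (target \<kappa> \<alpha> a)
  then show ?case using dot_self_nonneg[of "a - \<kappa>"] D_pos by (simp add: link_def)
qed auto

text \<open>An asymmetric relation in which every edge goes forward: paths, hubs, grid layers, and
  levels within a layer.\<close>

fun before :: "node \<Rightarrow> node \<Rightarrow> bool" where
  "before (Path _ i) (Path _ j) \<longleftrightarrow> i < j"
| "before (Path _ _) (Hub _ _ _) \<longleftrightarrow> True"
| "before (Hub _ _ _) (Grid _ _ _ _) \<longleftrightarrow> True"
| "before (Grid _ c k _) (Grid _ d l _) \<longleftrightarrow> k < l \<or> k = l \<and> c < d"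
| "before _ _ \<longleftrightarrow> False"

lemma asym_E: "(x, y) \<in> E \<Longrightarrow> (y, x) \<notin> E"
proof -
  have "(x, y) \<in> E \<Longrightarrow> before x y" for x y by (induction rule: E.cases) auto
  moreover have "\<not> (before x y \<and> before y x)" by (cases x; cases y) auto
  ultimately show "(x, y) \<in> E \<Longrightarrow> (y, x) \<notin> E" by blast
qed

sublocale weighted_graph V E weight
  by unfold_locales (use finite_V E_subset asym_E weight_pos in auto)

end

section \<open>The potential of a target\<close>

text \<open>The data of one edge to be forced: copy \<open>a\<close>, offset \<open>h\<close>,
  endpoints \<alpha> and \<beta> of a line, and the layer \<open>k0\<close> of the edge on it.
  Separating the first coordinates at \<open>m\<^sup>2\<close> makes that of the direction positive,
  so its level \<open>c0\<close> is in range.\<close>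

locale target = construction +
  fixes a h \<alpha> \<beta> :: v3 and k0 :: int
  assumes a: "a \<in> box3 D D D" and h: "h \<in> box3 D D D"
    and \<alpha>: "\<alpha> \<in> A" "fst \<alpha> < m\<^sup>2" and \<beta>: "\<beta> \<in> A" "m\<^sup>2 \<le> fst \<beta>"
    and k0: "0 \<le> k0" "k0 < D"
begin

definition \<kappa> :: v3 where "\<kappa> = a - h"
definition \<kappa>' :: v3 where "\<kappa>' = a + h"
definition v :: v3 where "v = \<beta> - \<alpha>"
definition vy :: int where "vy = fst (snd v)"
definition vz :: int where "vz = snd (snd v)"
definition q :: int where "q = vy\<^sup>2 + vz\<^sup>2"
definition c0 :: int where "c0 = fst v + q"
definition L :: v3 where "L = (1, 2 * vy, 2 * vz)"
definition line :: "int \<Rightarrow> v3" where "line c = step c vy vz"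
definition z0 :: v3 where "z0 = scale D \<alpha> + h"
definition sW :: int where "sW = slot \<kappa> \<alpha>"
definition tW :: int where "tW = slot \<kappa>' \<beta>"
definition sX :: int where "sX = base - sW"
definition tX :: int where "tX = base - tW"
text \<open>Length of the intended path up to the selected target hub: \<open>sX\<close> to the
  source hub, two links, \<open>D\<close> grid steps and \<open>c0\<close> bus steps.\<close>

definition Y :: int where "Y = sX + 2 * link + 2 * dot h h + D + c0"
text \<open>Offset from the selected hub in units of \<open>D\<close>. At the selected position it
  follows \<open>L\<close>, in accordance with the grid points attached there; elsewhere the crude
  \<open>excess\<close> suffices.\<close>

definition sE :: "v3 \<Rightarrow> v3 \<Rightarrow> int" where
  "sE \<kappa>\<^sub>1 \<alpha>\<^sub>1 = (if \<kappa>\<^sub>1 = \<kappa> then dot L (\<alpha>\<^sub>1 - \<alpha>) else excess)"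
definition tE :: "v3 \<Rightarrow> v3 \<Rightarrow> int" where
  "tE \<kappa>\<^sub>1 \<beta>\<^sub>1 = (if \<kappa>\<^sub>1 = \<kappa>' then dot L (\<beta> - \<beta>\<^sub>1) else excess)"

text \<open>
  On the grid this is \<open>D\<close> times the distance from the source along straight lines: \<open>L\<close> is the
  supporting functional of the paraboloid at \<open>v\<close>, and \<open>2 * dot h (b - a)\<close> is the tangent at \<open>a\<close> of
  the connection lengths.
\<close>
fun pot :: "node \<Rightarrow> int" where
  "pot (Path b i) = (if b then D * (Y + tX - (if i \<le> tW then i else tX))
     else D * (if i \<le> sW then i else sX))"
| "pot (Hub b \<kappa>\<^sub>1 \<alpha>\<^sub>1) = (if b then D * (Y - tE \<kappa>\<^sub>1 \<alpha>\<^sub>1) else D * (sX + sE \<kappa>\<^sub>1 \<alpha>\<^sub>1))"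
| "pot (Grid b c k z) = D * (sX + link + dot h h + 2 * dot h (b - a) + k)
     + c * (D - k) + dot L (z - z0) - k * q"

text \<open>Tight steps follow the direction with last coordinates \<open>vy\<close> and
  \<open>vz\<close> in every level, so the lines of all levels occur; only the one of level
  \<open>c0\<close> is cut after layer \<open>k0\<close>. The others end away from
  \<open>z0 + scale D v\<close>, at hubs other than the selected one.\<close>

fun reached :: "node \<Rightarrow> bool" where
  "reached (Path b i) \<longleftrightarrow> \<not> b \<and> i \<le> sW"
| "reached (Hub b \<kappa>\<^sub>1 \<alpha>\<^sub>1) \<longleftrightarrow> (if b then \<kappa>\<^sub>1 = \<kappa>' \<and> (\<exists>c. c \<noteq> c0 \<and> \<alpha>\<^sub>1 = \<alpha> + line c)
     else \<kappa>\<^sub>1 = \<kappa> \<and> \<alpha>\<^sub>1 = \<alpha>)"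
| "reached (Grid b c k z) \<longleftrightarrow> b = a \<and>
     (if k < D then z = z0 + scale k (line c) \<and> (c \<noteq> c0 \<or> k \<le> k0)
      else k = D \<and> (\<exists>c. c \<noteq> c0 \<and> z = z0 + scale D (line c)))"

definition faults :: "(node \<times> node) set" where
  "faults = {(Path False sW, Path False (sW + 1)), (Path True tW, Path True (tW + 1))}"

definition critical :: "node \<times> node" where
  "critical = (Grid a c0 k0 (z0 + scale k0 v),
     Grid a (if k0 + 1 = D then 0 else c0) (k0 + 1) (z0 + scale k0 v + v))"

section \<open>Bounds for the direction and the functional\<close>

lemma K_a: "\<kappa> \<in> K" "\<kappa>' \<in> K"
proof -
  obtain a1 a2 a3 where A: "a = (a1, a2, a3)" by (cases a)
  obtain h1 h2 h3 where H: "h = (h1, h2, h3)" by (cases h)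
  have "a - h \<in> K" "a + h \<in> K" using a h unfolding K_def A H box3_def by simp_all
  then show "\<kappa> \<in> K" "\<kappa>' \<in> K" by (simp_all only: \<kappa>_def \<kappa>'_def)
qed

lemma v_bounds: "\<bar>vy\<bar> < m" "\<bar>vz\<bar> < m" "0 < fst v" "fst v < 2 * m\<^sup>2"
proof -
  obtain x y z where x: "\<alpha> = (x, y, z)" by (cases \<alpha>)
  obtain x' y' z' where x': "\<beta> = (x', y', z')" by (cases \<beta>)
  have "\<bar>fst (snd (\<beta> - \<alpha>))\<bar> < m" "\<bar>snd (snd (\<beta> - \<alpha>))\<bar> < m" "0 < fst (\<beta> - \<alpha>)"
    "fst (\<beta> - \<alpha>) < 2 * m\<^sup>2"
    using \<alpha> \<beta> m_pos unfolding x x' A_def box3_def by auto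
  then show "\<bar>vy\<bar> < m" "\<bar>vz\<bar> < m" "0 < fst v" "fst v < 2 * m\<^sup>2"
    by (simp_all only: vy_def vz_def v_def)
qed

lemma v_line: "line c0 = v"
  by (simp add: line_def step_def c0_def q_def vy_def vz_def)

lemma line_inj: "line c = line d \<longleftrightarrow> c = d"
  by (simp add: line_def step_def)

text \<open>Completing the square: relative to \<open>line c\<close>, a step loses the squared
  distance of its last two coordinates from those of \<open>v\<close>, equally in every
  level.\<close>

lemma dot_L_step: "dot L (step c x y) = c + q - ((x - vy)\<^sup>2 + (y - vz)\<^sup>2)"
  by (simp add: L_def step_def q_def power2_eq_square algebra_simps)

lemma dot_L_v: "dot L v = c0 + q"
  using dot_L_step[of c0 vy vz] v_line by (simp add: line_def)

lemma sq_lt: "\<bar>x\<bar> < m \<Longrightarrow> \<bar>y\<bar> < m \<Longrightarrow> (x - y)\<^sup>2 < 4 * m\<^sup>2"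
  using abs_le_square_iff[of "2 * m" "x - y"] by (auto simp: power_mult_distrib)

lemma q_bounds: "0 \<le> q" "q < 2 * m\<^sup>2"
proof -
  have "vy\<^sup>2 < m\<^sup>2" "vz\<^sup>2 < m\<^sup>2"
    using v_bounds(1,2) abs_le_square_iff[of m vy] abs_le_square_iff[of m vz] by auto
  then show "0 \<le> q" "q < 2 * m\<^sup>2" by (auto simp: q_def)
qed

lemma c0_bounds: "0 < c0" "c0 < 4 * m\<^sup>2"
  using q_bounds v_bounds by (auto simp: c0_def)

lemma dot_L_bound:
  assumes "\<bar>fst u\<bar> \<le> B" "\<bar>fst (snd u)\<bar> \<le> C" "\<bar>snd (snd u)\<bar> \<le> C"
  shows "\<bar>dot L u\<bar> \<le> B + 4 * m * C"
proof -
  have "\<bar>vy * fst (snd u)\<bar> \<le> m * C" "\<bar>vz * snd (snd u)\<bar> \<le> m * C"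
    unfolding abs_mult using assms v_bounds(1,2) m_pos by (auto intro!: mult_mono)
  moreover have "dot L u = fst u + 2 * (vy * fst (snd u)) + 2 * (vz * snd (snd u))"
    by (cases u) (simp add: L_def)
  ultimately show ?thesis using assms(1) by linarith
qed

lemma dot_L_A: "x \<in> A \<Longrightarrow> y \<in> A \<Longrightarrow> \<bar>dot L (x - y)\<bar> < D"
proof -
  assume "x \<in> A" "y \<in> A"
  then have "\<bar>dot L (x - y)\<bar> \<le> 2 * m\<^sup>2 + 4 * m * m"
    by (intro dot_L_bound; cases x; cases y; auto simp: A_def box3_def)
  moreover have "0 < m * m" using m_pos by simp
  ultimately show ?thesis by (simp add: D_def power2_eq_square)
qed

lemma dot_L_Z: "x \<in> Z \<Longrightarrow> y \<in> Z \<Longrightarrow> \<bar>dot L (x - y)\<bar> \<le> D * D"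
proof -
  assume "x \<in> Z" "y \<in> Z"
  then have "\<bar>dot L (x - y)\<bar> \<le> 2 * D * m\<^sup>2 + 4 * m * (D * m)"
    by (intro dot_L_bound; cases x; cases y; auto simp: Z_def box3_def)
  also have "\<dots> \<le> D * D" using m_pos by (simp add: D_def power2_eq_square)
  finally show ?thesis .
qed

text \<open>As \<open>\<bar>i\<bar> \<le> i * i\<close> for integers and the coefficients of
  \<open>L\<close> are at most \<open>2 * m\<close> in size, the functional is bounded by
  \<open>2 * m * dot d d\<close>, and \<open>2 * m < D\<close>. Hence another copy costs more in
  squared link length than it gains through \<open>L\<close>.\<close>

lemma dot_L_slack: "\<bar>dot L d\<bar> \<le> D * dot d d" "d \<noteq> 0 \<Longrightarrow> \<bar>dot L d\<bar> < D * dot d d"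
proof -
  obtain x y z where d: "d = (x, y, z)" by (cases d)
  have sq: "\<bar>i\<bar> \<le> i * i" for i :: int
    using mult_left_mono[of 1 "\<bar>i\<bar>" "\<bar>i\<bar>"] by (cases "i = 0") (auto simp: abs_mult_self_eq)
  have "\<bar>vy * y\<bar> \<le> m * (y * y)" "\<bar>vz * z\<bar> \<le> m * (z * z)"
    unfolding abs_mult using v_bounds(1,2) m_pos sq by (auto intro!: mult_mono)
  then have 1: "\<bar>dot L d\<bar> \<le> x * x + 2 * (m * (y * y)) + 2 * (m * (z * z))"
    using sq[of x] unfolding d by (simp add: L_def)
  also have "\<dots> \<le> 2 * m * dot d d"
    using m_pos mult_right_mono[of 1 "2 * m" "x * x"] by (simp add: d algebra_simps)
  finally have 2: "\<bar>dot L d\<bar> \<le> 2 * m * dot d d" .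
  have "2 * m < D" using D_pos m_pos by linarith
  then show "\<bar>dot L d\<bar> \<le> D * dot d d"
    using 2 mult_right_mono[of "2 * m" D "dot d d"] dot_self_nonneg[of d] by linarith
  assume "d \<noteq> 0"
  then have "x \<noteq> 0 \<or> y \<noteq> 0 \<or> z \<noteq> 0" by (auto simp: d zero_prod_def)
  moreover have "0 < i * i" if "i \<noteq> 0" for i :: int
    using that by (metis mult_eq_0_iff not_square_less_zero linorder_neqE)
  ultimately have "0 < dot d d"
    using zero_le_square[of x] zero_le_square[of y] zero_le_square[of z] unfolding d dot.simps
    by (smt (verit))
  then show "\<bar>dot L d\<bar> < D * dot d d"
    using 2 mult_strict_right_mono[OF \<open>2 * m < D\<close>, of "dot d d"] by linarith
qed

section \<open>Slack of hooks, links and grid steps\<close>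

lemma z0_Z: "z0 \<in> Z"
  unfolding z0_def using scale_A_add_in_Z[OF \<alpha>(1) h] .

lemma slots: "0 \<le> sW" "sW < len" "0 \<le> tW" "tW < len"
  using slot_bounds K_a \<alpha> \<beta> by (auto simp: sW_def tW_def)

lemma excess_len: "excess < len" "D < excess"
proof -
  have "1 \<le> D ^ 3" using D_pos by simp
  then have "D\<^sup>2 * 1 \<le> D\<^sup>2 * D ^ 3" by (intro mult_left_mono) auto
  then have "D\<^sup>2 \<le> D ^ 5" by (simp add: numeral_eq_Suc)
  moreover have "0 < D\<^sup>2" using D_pos by simp
  ultimately show "excess < len" unfolding excess_def len_def by linarith
  show "D < excess" using D_pos by (simp add: excess_def)
qed

text \<open>Serves both sides, whose linear offsets have opposite signs; hence the absolute value of
  \<open>x\<close>. Before the fault the claim comes down to \<open>x\<close> being less than the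
  slot difference, which the gap lemmas give. Behind it the path potential is constant, and
  \<open>\<bar>x\<bar> \<le> excess\<close> stays below the hook weight.\<close>

lemma hook_slack:
  assumes "\<kappa>\<^sub>1 \<in> K" "\<alpha>\<^sub>1 \<in> A" "\<kappa>\<^sub>2 \<in> K" "\<alpha>\<^sub>2 \<in> A" "(\<kappa>\<^sub>1, \<alpha>\<^sub>1) \<noteq> (\<kappa>\<^sub>2, \<alpha>\<^sub>2)"
    and x: "\<kappa>\<^sub>1 = \<kappa>\<^sub>2 \<Longrightarrow> \<bar>x\<bar> = \<bar>dot L (\<alpha>\<^sub>1 - \<alpha>\<^sub>2)\<bar>" "\<kappa>\<^sub>1 \<noteq> \<kappa>\<^sub>2 \<Longrightarrow> x = excess"
  shows "\<bar>(if slot \<kappa>\<^sub>1 \<alpha>\<^sub>1 \<le> slot \<kappa>\<^sub>2 \<alpha>\<^sub>2 then slot \<kappa>\<^sub>1 \<alpha>\<^sub>1 else base - slot \<kappa>\<^sub>2 \<alpha>\<^sub>2)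
    - (base - slot \<kappa>\<^sub>2 \<alpha>\<^sub>2 + x)\<bar> < base - 2 * slot \<kappa>\<^sub>1 \<alpha>\<^sub>1"
proof -
  have ne: "slot \<kappa>\<^sub>1 \<alpha>\<^sub>1 \<noteq> slot \<kappa>\<^sub>2 \<alpha>\<^sub>2" using slot_inj assms(1-5) by blast
  have bounds: "0 \<le> slot \<kappa>\<^sub>1 \<alpha>\<^sub>1" "slot \<kappa>\<^sub>1 \<alpha>\<^sub>1 < len" "0 \<le> slot \<kappa>\<^sub>2 \<alpha>\<^sub>2" "slot \<kappa>\<^sub>2 \<alpha>\<^sub>2 < len"
    using slot_bounds assms(1-4) by auto
  have x': "\<bar>x\<bar> \<le> excess"
    using x dot_L_A[OF assms(2,4)] excess_len D_pos by (cases "\<kappa>\<^sub>1 = \<kappa>\<^sub>2") auto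
  have "x < slot \<kappa>\<^sub>2 \<alpha>\<^sub>2 - slot \<kappa>\<^sub>1 \<alpha>\<^sub>1" if le: "slot \<kappa>\<^sub>1 \<alpha>\<^sub>1 \<le> slot \<kappa>\<^sub>2 \<alpha>\<^sub>2"
  proof (cases "\<kappa>\<^sub>1 = \<kappa>\<^sub>2")
    case True
    then have "\<bar>dot L (\<alpha>\<^sub>1 - \<alpha>\<^sub>2)\<bar> < slot \<kappa>\<^sub>1 \<alpha>\<^sub>2 - slot \<kappa>\<^sub>1 \<alpha>\<^sub>1"
      unfolding L_def using assms(2,4,5) le v_bounds by (intro slot_gap_A) auto
    then show ?thesis using x(1)[OF True] True by simp
  next
    case False
    then show ?thesis using slot_gap_K[OF assms(1,3,2,4) False le] x(2) ne by linarith
  qed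
  note * = this
  show ?thesis
  proof (cases "slot \<kappa>\<^sub>1 \<alpha>\<^sub>1 \<le> slot \<kappa>\<^sub>2 \<alpha>\<^sub>2")
    case True
    then show ?thesis using *[OF True] x' bounds excess_len unfolding base_def if_P[OF True] by linarith
  next
    case False
    then show ?thesis using x' bounds excess_len unfolding base_def if_not_P[OF False] by linarith
  qed
qed

lemma hook_slack_False:
  assumes "\<kappa>\<^sub>1 \<in> K" "\<alpha>\<^sub>1 \<in> A" "(\<kappa>\<^sub>1, \<alpha>\<^sub>1) \<noteq> (\<kappa>, \<alpha>)"
  shows "\<bar>pot (Hub False \<kappa>\<^sub>1 \<alpha>\<^sub>1) - pot (Path False (slot \<kappa>\<^sub>1 \<alpha>\<^sub>1))\<bar> < D * (base - 2 * slot \<kappa>\<^sub>1 \<alpha>\<^sub>1)"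
proof -
  have "\<bar>(if slot \<kappa>\<^sub>1 \<alpha>\<^sub>1 \<le> sW then slot \<kappa>\<^sub>1 \<alpha>\<^sub>1 else sX) - (sX + sE \<kappa>\<^sub>1 \<alpha>\<^sub>1)\<bar>
    < base - 2 * slot \<kappa>\<^sub>1 \<alpha>\<^sub>1"
    unfolding sW_def sX_def
    using assms K_a \<alpha> by (intro hook_slack) (auto simp: sE_def)
  then have "D * \<bar>(if slot \<kappa>\<^sub>1 \<alpha>\<^sub>1 \<le> sW then slot \<kappa>\<^sub>1 \<alpha>\<^sub>1 else sX) - (sX + sE \<kappa>\<^sub>1 \<alpha>\<^sub>1)\<bar>
    < D * (base - 2 * slot \<kappa>\<^sub>1 \<alpha>\<^sub>1)"
    using D_pos by (intro mult_strict_left_mono) auto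
  moreover have "pot (Hub False \<kappa>\<^sub>1 \<alpha>\<^sub>1) - pot (Path False (slot \<kappa>\<^sub>1 \<alpha>\<^sub>1)) =
    - D * ((if slot \<kappa>\<^sub>1 \<alpha>\<^sub>1 \<le> sW then slot \<kappa>\<^sub>1 \<alpha>\<^sub>1 else sX) - (sX + sE \<kappa>\<^sub>1 \<alpha>\<^sub>1))"
    by (simp add: algebra_simps)
  ultimately show ?thesis using D_pos by (simp add: abs_mult)
qed

lemma hook_slack_True:
  assumes "\<kappa>\<^sub>1 \<in> K" "\<alpha>\<^sub>1 \<in> A" "(\<kappa>\<^sub>1, \<alpha>\<^sub>1) \<noteq> (\<kappa>', \<beta>)"
  shows "\<bar>pot (Hub True \<kappa>\<^sub>1 \<alpha>\<^sub>1) - pot (Path True (slot \<kappa>\<^sub>1 \<alpha>\<^sub>1))\<bar> < D * (base - 2 * slot \<kappa>\<^sub>1 \<alpha>\<^sub>1)"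
proof -
  have "\<bar>(if slot \<kappa>\<^sub>1 \<alpha>\<^sub>1 \<le> tW then slot \<kappa>\<^sub>1 \<alpha>\<^sub>1 else tX) - (tX + tE \<kappa>\<^sub>1 \<alpha>\<^sub>1)\<bar>
    < base - 2 * slot \<kappa>\<^sub>1 \<alpha>\<^sub>1"
    unfolding tW_def tX_def
    using assms K_a \<beta> by (intro hook_slack) (auto simp: tE_def dot_diff_right abs_minus_commute)
  then have "D * \<bar>(if slot \<kappa>\<^sub>1 \<alpha>\<^sub>1 \<le> tW then slot \<kappa>\<^sub>1 \<alpha>\<^sub>1 else tX) - (tX + tE \<kappa>\<^sub>1 \<alpha>\<^sub>1)\<bar>
    < D * (base - 2 * slot \<kappa>\<^sub>1 \<alpha>\<^sub>1)"
    using D_pos by (intro mult_strict_left_mono) auto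
  moreover have "pot (Hub True \<kappa>\<^sub>1 \<alpha>\<^sub>1) - pot (Path True (slot \<kappa>\<^sub>1 \<alpha>\<^sub>1)) =
    D * ((if slot \<kappa>\<^sub>1 \<alpha>\<^sub>1 \<le> tW then slot \<kappa>\<^sub>1 \<alpha>\<^sub>1 else tX) - (tX + tE \<kappa>\<^sub>1 \<alpha>\<^sub>1))"
    by (simp add: algebra_simps)
  ultimately show ?thesis using D_pos by (simp add: abs_mult)
qed

lemma hook_selected:
  "pot (Hub False \<kappa> \<alpha>) - pot (Path False sW) = D * (base - 2 * sW)"
  "pot (Path True tW) - pot (Hub True \<kappa>' \<beta>) = D * (base - 2 * tW)"
  by (simp_all add: sE_def tE_def sX_def tX_def dot_diff_right algebra_simps)

lemma box_diff_bounds: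
  assumes "b \<in> box3 D D D"
  shows "\<bar>dot h (b - a)\<bar> \<le> 3 * D\<^sup>2" "dot (b - a) (b - a) \<le> 6 * D\<^sup>2"
  using dot_box_bounds[OF h assms] dot_box_bounds[OF h a] dot_box_bounds[OF assms a]
    dot_box_bounds[OF assms assms] dot_box_bounds[OF a a] dot_commute[of a b]
  by (auto simp: dot_simps)

text \<open>With \<open>d = b - a\<close>, the link length contains
  \<open>dot h h + 2 * dot h d + dot d d\<close>, of which the potential has the tangent part; the
  loss \<open>D * dot d d - dot L d\<close> is positive unless \<open>d = 0\<close>. At other hub
  positions \<open>excess\<close> covers all variation.\<close>

lemma source_slack:
  assumes "\<kappa>\<^sub>1 \<in> K" "\<alpha>\<^sub>1 \<in> A" "b \<in> box3 D D D" "b - \<kappa>\<^sub>1 \<in> box3 D D D"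
  defines "x \<equiv> Hub False \<kappa>\<^sub>1 \<alpha>\<^sub>1" and "y \<equiv> Grid b 0 0 (scale D \<alpha>\<^sub>1 + (b - \<kappa>\<^sub>1))"
  shows "pot y - pot x \<le> D * (link + dot (b - \<kappa>\<^sub>1) (b - \<kappa>\<^sub>1))"
    and "- (D * (link + dot (b - \<kappa>\<^sub>1) (b - \<kappa>\<^sub>1))) < pot y - pot x"
    and "\<kappa>\<^sub>1 = \<kappa> \<Longrightarrow> pot y - pot x = D * (link + dot (b - \<kappa>\<^sub>1) (b - \<kappa>\<^sub>1)) \<Longrightarrow> b = a"
proof -
  have D3: "0 < D" "D * D = D\<^sup>2" "8 * D \<le> D\<^sup>2" using D_pos by (auto simp: power2_eq_square)
  note hb = dot_box_bounds[OF h h] dot_box_bounds[OF assms(4,4)] box_diff_bounds[OF assms(3)]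
  have "pot y - pot x \<le> D * (link + dot (b - \<kappa>\<^sub>1) (b - \<kappa>\<^sub>1)) \<and>
    - (D * (link + dot (b - \<kappa>\<^sub>1) (b - \<kappa>\<^sub>1))) < pot y - pot x \<and>
    (\<kappa>\<^sub>1 = \<kappa> \<longrightarrow> pot y - pot x = D * (link + dot (b - \<kappa>\<^sub>1) (b - \<kappa>\<^sub>1)) \<longrightarrow> b = a)"
  proof (cases "\<kappa>\<^sub>1 = \<kappa>")
    case True
    define d where "d = b - a"
    have b: "b - \<kappa>\<^sub>1 = h + d" "scale D \<alpha>\<^sub>1 + (b - \<kappa>\<^sub>1) - z0 = scale D (\<alpha>\<^sub>1 - \<alpha>) + d"
      by (simp_all add: True \<kappa>_def d_def z0_def scale_diff[symmetric] algebra_simps)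
    have diff: "pot y - pot x = D * (link + dot (b - \<kappa>\<^sub>1) (b - \<kappa>\<^sub>1)) - (D * dot d d - dot L d)"
      unfolding x_def y_def pot.simps b
      by (simp add: sE_def True b z0_def dot_simps d_def[symmetric] dot_commute[of d h] algebra_simps)
    have "D * dot d d \<le> D * (6 * D\<^sup>2)" "0 \<le> D * dot d d"
      using hb D3 dot_self_nonneg[of d] by (auto simp: d_def intro: mult_left_mono)
    moreover have "D * (20 * D\<^sup>2) \<le> D * (link + dot (b - \<kappa>\<^sub>1) (b - \<kappa>\<^sub>1))"
      using hb D3 by (intro mult_left_mono) (auto simp: link_def)
    moreover have "0 < D * D\<^sup>2" using D3 by simp
    ultimately show ?thesis
      using dot_L_slack[of d] unfolding diff
      by (cases "d = 0") (auto simp: d_def)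
  next
    case False
    let ?z = "scale D \<alpha>\<^sub>1 + (b - \<kappa>\<^sub>1)"
    have "?z \<in> Z" using assms(2,4) by (rule scale_A_add_in_Z)
    then have z: "\<bar>dot L (?z - z0)\<bar> \<le> D * D" using dot_L_Z z0_Z by blast
    have diff: "pot y - pot x = D * (link + dot h h + 2 * dot h (b - a) - excess) + dot L (?z - z0)"
      unfolding x_def y_def pot.simps using False by (simp add: sE_def algebra_simps)
    have "D * (link + dot h h + 2 * dot h (b - a) - excess + D) \<le> D * (link + dot (b - \<kappa>\<^sub>1) (b - \<kappa>\<^sub>1))"
      using hb D3 by (intro mult_left_mono) (auto simp: excess_def link_def)
    moreover have "D * - (link + dot (b - \<kappa>\<^sub>1) (b - \<kappa>\<^sub>1)) < D * (link + dot h h + 2 * dot h (b - a) - excess - D)"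
      using hb D3 by (intro mult_strict_left_mono) (auto simp: excess_def link_def)
    ultimately show ?thesis using z False unfolding diff by (auto simp: algebra_simps)
  qed
  then show "pot y - pot x \<le> D * (link + dot (b - \<kappa>\<^sub>1) (b - \<kappa>\<^sub>1))"
    and "- (D * (link + dot (b - \<kappa>\<^sub>1) (b - \<kappa>\<^sub>1))) < pot y - pot x"
    and "\<kappa>\<^sub>1 = \<kappa> \<Longrightarrow> pot y - pot x = D * (link + dot (b - \<kappa>\<^sub>1) (b - \<kappa>\<^sub>1)) \<Longrightarrow> b = a"
    by blast+
qed

text \<open>Now \<open>b - \<kappa>' = d - h\<close>, so the tangent term has the opposite sign and
  cancels that of the source side; the loss is again \<open>D * dot d d - dot L d\<close>.\<close>

lemma target_slack:
  assumes "\<kappa>\<^sub>1 \<in> K" "\<alpha>\<^sub>1 \<in> A" "b \<in> box3 D D D" "\<kappa>\<^sub>1 - b \<in> box3 D D D"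
  defines "x \<equiv> Hub True \<kappa>\<^sub>1 \<alpha>\<^sub>1" and "y \<equiv> Grid b 0 D (scale D \<alpha>\<^sub>1 + (\<kappa>\<^sub>1 - b))"
  shows "pot x - pot y \<le> D * (link + dot (b - \<kappa>\<^sub>1) (b - \<kappa>\<^sub>1))"
    and "- (D * (link + dot (b - \<kappa>\<^sub>1) (b - \<kappa>\<^sub>1))) < pot x - pot y"
proof -
  have D3: "0 < D" "D * D = D\<^sup>2" "8 * D \<le> D\<^sup>2" using D_pos by (auto simp: power2_eq_square)
  have "dot (b - \<kappa>\<^sub>1) (b - \<kappa>\<^sub>1) = dot (\<kappa>\<^sub>1 - b) (\<kappa>\<^sub>1 - b)" by (simp add: dot_simps)
  note hb = dot_box_bounds[OF h h] dot_box_bounds[OF assms(4,4)] box_diff_bounds[OF assms(3)] this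
  have "pot x - pot y \<le> D * (link + dot (b - \<kappa>\<^sub>1) (b - \<kappa>\<^sub>1)) \<and>
    - (D * (link + dot (b - \<kappa>\<^sub>1) (b - \<kappa>\<^sub>1))) < pot x - pot y"
  proof (cases "\<kappa>\<^sub>1 = \<kappa>'")
    case True
    define d where "d = b - a"
    have b: "b - \<kappa>\<^sub>1 = d - h" "scale D \<alpha>\<^sub>1 + (\<kappa>\<^sub>1 - b) - z0 = scale D (\<alpha>\<^sub>1 - \<alpha>) - d"
      by (simp_all add: True \<kappa>'_def d_def z0_def scale_diff[symmetric] algebra_simps)
    have \<beta>: "dot L \<beta> = dot L \<alpha> + c0 + q" using dot_L_v by (simp add: v_def dot_simps)
    have diff: "pot x - pot y = D * (link + dot (b - \<kappa>\<^sub>1) (b - \<kappa>\<^sub>1)) - (D * dot d d - dot L d)"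
      unfolding x_def y_def pot.simps b
      by (simp add: tE_def Y_def True b \<beta> z0_def dot_simps d_def[symmetric] dot_commute[of d h] algebra_simps)
    have "D * dot d d \<le> D * (6 * D\<^sup>2)" "0 \<le> D * dot d d"
      using hb D3 dot_self_nonneg[of d] by (auto simp: d_def intro: mult_left_mono)
    moreover have "D * (20 * D\<^sup>2) \<le> D * (link + dot (b - \<kappa>\<^sub>1) (b - \<kappa>\<^sub>1))"
      using hb D3 by (intro mult_left_mono) (auto simp: link_def)
    moreover have "0 < D * D\<^sup>2" using D3 by simp
    ultimately show ?thesis
      using dot_L_slack(1)[of d] unfolding diff by auto
  next
    case False
    let ?z = "scale D \<alpha>\<^sub>1 + (\<kappa>\<^sub>1 - b)"
    have "?z \<in> Z" using assms(2,4) by (rule scale_A_add_in_Z)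
    then have z: "\<bar>dot L (?z - z0)\<bar> \<le> D * D" using dot_L_Z z0_Z by blast
    have "\<bar>c0 + q\<bar> < D" using dot_L_A[OF \<beta>(1) \<alpha>(1)] dot_L_v by (simp add: v_def)
    note hb = hb this
    have diff: "pot x - pot y = D * (link + dot h h - 2 * dot h (b - a) - excess + (c0 + q)) - dot L (?z - z0)"
      unfolding x_def y_def pot.simps using False by (simp add: tE_def Y_def algebra_simps)
    have "D * (link + dot h h - 2 * dot h (b - a) - excess + (c0 + q) + D) \<le> D * (link + dot (b - \<kappa>\<^sub>1) (b - \<kappa>\<^sub>1))"
      using hb D3 by (intro mult_left_mono) (auto simp: excess_def link_def)
    moreover have "D * - (link + dot (b - \<kappa>\<^sub>1) (b - \<kappa>\<^sub>1)) < D * (link + dot h h - 2 * dot h (b - a) - excess + (c0 + q) - D)"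
      using hb D3 by (intro mult_strict_left_mono) (auto simp: excess_def link_def)
    ultimately show ?thesis using z unfolding diff by (auto simp: algebra_simps)
  qed
  then show "pot x - pot y \<le> D * (link + dot (b - \<kappa>\<^sub>1) (b - \<kappa>\<^sub>1))"
    and "- (D * (link + dot (b - \<kappa>\<^sub>1) (b - \<kappa>\<^sub>1))) < pot x - pot y"
    by blast+
qed

lemma pot_bus: "pot (Grid b (c + 1) 0 z) - pot (Grid b c 0 z) = D"
  by (simp add: algebra_simps)

lemma pot_step:
  "pot (Grid b (if k + 1 = D then 0 else c) (k + 1) (z + step c x y)) - pot (Grid b c k z)
    = D - ((x - vy)\<^sup>2 + (y - vz)\<^sup>2)"
proof -
  \<comment> \<open>In the last layer the level term \<open>c * (D - k)\<close> vanishes, so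
    resetting the level to 0 leaves the potential unchanged.\<close>
  have "pot (Grid b (if k + 1 = D then 0 else c) (k + 1) (z + step c x y)) =
    pot (Grid b c (k + 1) (z + step c x y))" by simp
  then show ?thesis by (simp add: dot_simps dot_L_step algebra_simps)
qed

lemma step_bounds:
  assumes "\<bar>x\<bar> < m" "\<bar>y\<bar> < m"
  shows "0 \<le> (x - vy)\<^sup>2 + (y - vz)\<^sup>2" "(x - vy)\<^sup>2 + (y - vz)\<^sup>2 < D"
    "(x - vy)\<^sup>2 + (y - vz)\<^sup>2 = 0 \<longleftrightarrow> x = vy \<and> y = vz"
proof -
  show "0 \<le> (x - vy)\<^sup>2 + (y - vz)\<^sup>2" by simp
  \<comment> \<open>Two squares below \<open>4 * m\<^sup>2\<close>, whence the choice
    \<open>D = 8 * m\<^sup>2\<close>: the potential strictly increases along each step, so no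
    backward step is tight.\<close>
  show "(x - vy)\<^sup>2 + (y - vz)\<^sup>2 < D"
    using sq_lt[OF assms(1) v_bounds(1)] sq_lt[OF assms(2) v_bounds(2)] by (simp add: D_def)
  show "(x - vy)\<^sup>2 + (y - vz)\<^sup>2 = 0 \<longleftrightarrow> x = vy \<and> y = vz"
    by (simp add: sum_power2_eq_zero_iff)
qed

text \<open>The Lipschitz and closure hypotheses of \<open>forced_unit_edge\<close>, checked for
  each kind of edge. Most edges have strict slack; closure matters only where an edge can be
  tight.\<close>

lemma certificate:
  assumes xy: "(x, y) \<in> E" "(x, y) \<notin> faults"
  shows "\<bar>pot x - pot y\<bar> \<le> D * int (weight x y)" (is ?lip)
    and "(x, y) \<noteq> critical \<Longrightarrow> reached x \<Longrightarrow> pot y = pot x + D * int (weight x y) \<Longrightarrow> reached y"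
      (is "_ \<Longrightarrow> _ \<Longrightarrow> _ \<Longrightarrow> ?up")
    and "reached y \<Longrightarrow> pot x = pot y + D * int (weight x y) \<Longrightarrow> reached x"
      (is "_ \<Longrightarrow> _ \<Longrightarrow> ?down")
proof -
  have D0: "0 < D" using D_pos by simp
  from xy(1) have "\<bar>pot x - pot y\<bar> \<le> D * int (weight x y) \<and>
    ((x, y) \<noteq> critical \<longrightarrow> reached x \<longrightarrow> pot y = pot x + D * int (weight x y) \<longrightarrow> reached y) \<and>
    (reached y \<longrightarrow> pot x = pot y + D * int (weight x y) \<longrightarrow> reached x)"
  proof cases
    case (path i b)
    have ne: "\<not> b \<Longrightarrow> i \<noteq> sW" "b \<Longrightarrow> i \<noteq> tW"
      using xy(2) path by (auto simp: faults_def)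
    have "pot y - pot x = (if b then (if i < tW then - D else 0) else (if i < sW then D else 0))"
      using path(1,2) ne by (cases b) (auto simp: algebra_simps)
    then show ?thesis using path(1,2) ne D0 by (cases b) (auto split: if_splits)
  next
    case (hook \<kappa>\<^sub>1 \<alpha>\<^sub>1 b)
    have "0 < base - 2 * slot \<kappa>\<^sub>1 \<alpha>\<^sub>1"
      using slot_bounds[OF hook(3,4)] by (simp add: base_def)
    then have w: "int (weight x y) = base - 2 * slot \<kappa>\<^sub>1 \<alpha>\<^sub>1" "0 < D * (base - 2 * slot \<kappa>\<^sub>1 \<alpha>\<^sub>1)"
      using hook D0 by simp_all
    show ?thesis
    proof (cases b)
      case True
      show ?thesis
      proof (cases "(\<kappa>\<^sub>1, \<alpha>\<^sub>1) = (\<kappa>', \<beta>)")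
        case eq: True
        \<comment> \<open>The selected target hub lies on the line of level \<open>c0\<close> only,
          so it is not reached.\<close>
        have "c = c0" if "\<beta> = \<alpha> + line c" for c
        proof -
          have "line c = v" using that unfolding v_def by (metis add_diff_cancel_left')
          then show ?thesis using v_line line_inj by metis
        qed
        then have "\<not> reached (Hub True \<kappa>' \<beta>)" by fastforce
        then have "\<not> reached y" using eq True hook(2) by simp
        moreover have "\<not> reached x" using hook True by simp
        moreover have "pot x - pot y = D * int (weight x y)"
          unfolding w using hook_selected(2) eq hook True by (simp add: tW_def)
        ultimately show ?thesis using w by simp
      next
        case False
        show ?thesis
          unfolding w using hook_slack_True[OF hook(3,4) False] hook True by auto
      qed
    next
      case False
      show ?thesis
      proof (cases "(\<kappa>\<^sub>1, \<alpha>\<^sub>1) = (\<kappa>, \<alpha>)")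
        case eq: True
        have "reached x" "reached y" using eq False hook by (auto simp: sW_def)
        moreover have "pot y - pot x = D * int (weight x y)"
          unfolding w using hook_selected(1) eq hook False by (simp add: sW_def)
        ultimately show ?thesis using w by simp
      next
        case neq: False
        show ?thesis
          unfolding w using hook_slack_False[OF hook(3,4) neq] hook False by auto
      qed
    qed
  next
    case (source \<kappa>\<^sub>1 \<alpha>\<^sub>1 b)
    have w: "int (weight x y) = link + dot (b - \<kappa>\<^sub>1) (b - \<kappa>\<^sub>1)"
      using source dot_self_nonneg[of "b - \<kappa>\<^sub>1"] by (simp add: link_def)
    note s = source_slack[OF source(3-6), folded source(1,2)]
    have "reached y" if "reached x" "pot y - pot x = D * (link + dot (b - \<kappa>\<^sub>1) (b - \<kappa>\<^sub>1))"
    proof -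
      have "\<kappa>\<^sub>1 = \<kappa>" "\<alpha>\<^sub>1 = \<alpha>" using that(1) source(1) by auto
      moreover have "b = a" using s(3)[OF \<open>\<kappa>\<^sub>1 = \<kappa>\<close>] that(2) by simp
      ultimately show ?thesis
        using source(2) k0 D0 by (auto simp: z0_def \<kappa>_def)
    qed
    then show ?thesis using s(1,2) unfolding w by auto
  next
    case (target \<kappa>\<^sub>1 \<alpha>\<^sub>1 b)
    have w: "int (weight x y) = link + dot (b - \<kappa>\<^sub>1) (b - \<kappa>\<^sub>1)"
      using target dot_self_nonneg[of "b - \<kappa>\<^sub>1"] by (simp add: link_def)
    note s = target_slack[OF target(3-6), folded target(1,2)]
    \<comment> \<open>The point in the last layer splits uniquely into an endpoint and an offset,
      which identifies the hub.\<close>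
    have "reached x" if y: "reached y"
    proof -
      have "b = a" using y target(2) by simp
      obtain c where c: "c \<noteq> c0" "scale D \<alpha>\<^sub>1 + (\<kappa>\<^sub>1 - b) = z0 + scale D (line c)"
        using y[unfolded target(2)] by auto
      then have "scale D \<alpha>\<^sub>1 + (\<kappa>\<^sub>1 - b) = scale D (\<alpha> + line c) + h"
        by (simp add: z0_def scale_add algebra_simps)
      then have "\<alpha>\<^sub>1 = \<alpha> + line c \<and> \<kappa>\<^sub>1 - b = h"
        using target(6) h by (rule scale_add_box_inj)
      moreover from this have "\<kappa>\<^sub>1 = \<kappa>'"
        unfolding \<kappa>'_def \<open>b = a\<close> by (metis add.commute diff_add_cancel)
      ultimately show ?thesis using c(1) target(1) by auto
    qed
    then show ?thesis using s unfolding w by auto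
  next
    case (bus b c z)
    have d: "pot y - pot x = D" unfolding bus(1,2) by (rule pot_bus)
    have w: "int (weight x y) = 1" using bus by simp
    have "reached x \<Longrightarrow> reached y" using bus k0 D0 by auto
    then show ?thesis using d D0 unfolding w by auto
  next
    case (step b c k z x' y')
    note st = step
    have d: "pot y - pot x = D - ((x' - vy)\<^sup>2 + (y' - vz)\<^sup>2)"
      unfolding st(1,2) by (rule pot_step)
    have w: "int (weight x y) = 1" using st by simp
    note r = step_bounds[OF st(9,10)]
    have "reached y" if "reached x" "x' = vy \<and> y' = vz" "(x, y) \<noteq> critical"
    proof -
      have b: "b = a" "z = z0 + scale k (line c)" "c \<noteq> c0 \<or> k \<le> k0"
        using that(1)[unfolded st(1)] st(7) by auto
      have z': "z + step c x' y' = z0 + scale (k + 1) (line c)"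
        using b that(2) by (simp add: scale_add_left line_def algebra_simps)
      \<comment> \<open>At level \<open>c0\<close> and layer \<open>k0\<close> this step would be
        \<open>critical\<close> itself.\<close>
      have "c \<noteq> c0 \<or> k < k0"
        using that(2,3) b st(1,2) v_line by (auto simp: critical_def line_def)
      show ?thesis
      proof (cases "k + 1 = D")
        case True
        then have "c \<noteq> c0" using \<open>c \<noteq> c0 \<or> k < k0\<close> k0(2) by linarith
        then show ?thesis unfolding st(2) z' using True b(1) by auto
      next
        case False
        then show ?thesis unfolding st(2) z' using st(7) b(1) \<open>c \<noteq> c0 \<or> k < k0\<close> by auto
      qed
    qed
    moreover define gap where "gap = (x' - vy)\<^sup>2 + (y' - vz)\<^sup>2"
    ultimately show ?thesis using d r D0 unfolding w gap_def[symmetric] by auto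
  qed
  then show ?lip and "(x, y) \<noteq> critical \<Longrightarrow> reached x \<Longrightarrow> pot y = pot x + D * int (weight x y) \<Longrightarrow> ?up"
    and "reached y \<Longrightarrow> pot x = pot y + D * int (weight x y) \<Longrightarrow> ?down"
    by blast+
qed

section \<open>The critical walk\<close>

lemma line_in_Z:
  assumes "0 \<le> k" "k \<le> D"
  shows "z0 + scale k v \<in> Z"
proof -
  \<comment> \<open>The value is \<open>(D - k) * i + k * j + r\<close>, a convex combination scaled
    by \<open>D\<close> plus a remainder: at most \<open>D * (n - 1) + r\<close>.\<close>
  have *: "0 \<le> D * i + r + k * (j - i) \<and> D * i + r + k * (j - i) < D * n"
    if "0 \<le> i" "i < n" "0 \<le> j" "j < n" "0 \<le> r" "r < D" for i j n r
  proof -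
    have "(D - k) * i \<le> (D - k) * (n - 1)" "k * j \<le> k * (n - 1)"
      "0 \<le> (D - k) * i" "0 \<le> k * j"
      using that assms by (auto intro: mult_left_mono)
    then show ?thesis using that by (simp add: algebra_simps)
  qed
  obtain x y z where x: "\<alpha> = (x, y, z)" by (cases \<alpha>)
  obtain x' y' z' where x': "\<beta> = (x', y', z')" by (cases \<beta>)
  obtain r s t where r: "h = (r, s, t)" by (cases h)
  have "scale D \<alpha> + h + scale k (\<beta> - \<alpha>) \<in> Z"
    using \<alpha>(1) \<beta>(1) h *[of x "2 * m\<^sup>2" x' r] *[of y m y' s] *[of z m z' t]
    unfolding A_def Z_def box3_def x x' r by (simp add: algebra_simps)
  then show ?thesis by (simp only: z0_def v_def)
qed

lemma faults_props:
  "faults \<subseteq> E" "card faults \<le> 2" "(x, y) \<in> faults \<Longrightarrow> weight x y = 1"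
  using slots by (auto simp: faults_def card_insert_if intro: E.path)

lemma grid_step:
  assumes "0 \<le> k" "k < D"
  shows "(Grid a c0 k (z0 + scale k v), Grid a (if k + 1 = D then 0 else c0) (k + 1) (z0 + scale k v + v)) \<in> E"
proof -
  have z: "z0 + scale k v + v = z0 + scale (k + 1) v" by (simp add: scale_add_left algebra_simps)
  have "z0 + scale k v + v \<in> Z" unfolding z using line_in_Z[of "k + 1"] assms by simp
  then show ?thesis
    using E.step[of a c0 k "z0 + scale k v" vy vz] line_in_Z[of k] a assms c0_bounds v_bounds v_line
    by (simp add: line_def)
qed

lemma critical_in_E: "critical \<in> E" "weight (fst critical) (snd critical) = 1"
  using grid_step[OF k0] by (simp_all add: critical_def)

lemma not_fault_G: "(x, Grid b c k z) \<notin> faults" "(Grid b c k z, x) \<notin> faults" "(x, Hub d y w) \<notin> faults"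
  by (simp_all add: faults_def)

lemma path_walk:
  "int n \<le> (if b then tW else sW) \<Longrightarrow> weighted_walk (E - faults) weight n (Path b 0) (Path b (int n))"
proof (induction n)
  case (Suc n)
  then have "(Path b (int n), Path b (int n + 1)) \<in> E - faults"
    using slots by (auto simp: faults_def intro!: E.path split: if_splits)
  from weighted_walk.fwd[OF Suc.IH this] Suc.prems show ?case by (simp add: add.commute)
qed (simp add: weighted_walk.refl)

lemma bus_walk:
  "int n \<le> c0 \<Longrightarrow> weighted_walk (E - faults) weight n (Grid a 0 0 z0) (Grid a (int n) 0 z0)"
proof (induction n)
  case (Suc n)
  then have "(Grid a (int n) 0 z0, Grid a (int n + 1) 0 z0) \<in> E - faults"
    using c0_bounds a z0_Z not_fault_G by (auto intro!: E.bus)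
  from weighted_walk.fwd[OF Suc.IH this] Suc.prems show ?case by (simp add: add.commute)
qed (simp add: weighted_walk.refl)

lemma grid_walk:
  "int n \<le> D \<Longrightarrow> weighted_walk (E - faults) weight n (Grid a c0 0 z0)
    (Grid a (if int n = D then 0 else c0) (int n) (z0 + scale (int n) v))"
proof (induction n)
  case 0
  then show ?case using D_pos by (simp add: weighted_walk.refl)
next
  case (Suc n)
  have z: "z0 + scale (int n) v + v = z0 + scale (int (Suc n)) v"
    using scale_add_left[of "int n" 1 v] by (simp add: algebra_simps)
  have "(Grid a c0 (int n) (z0 + scale (int n) v),
     Grid a (if int n + 1 = D then 0 else c0) (int n + 1) (z0 + scale (int n) v + v)) \<in> E - faults"
    using grid_step[of "int n"] Suc.prems not_fault_G by simp
  moreover have "weighted_walk (E - faults) weight n (Grid a c0 0 z0) (Grid a c0 (int n) (z0 + scale (int n) v))"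
    using Suc by simp
  ultimately show ?case unfolding z using weighted_walk.fwd by (fastforce simp: add.commute)
qed

text \<open>Source path, hook, link, bus up to level \<open>c0\<close>, straight line, then link,
  hook and target path backwards. The potential rises by \<open>D\<close> per unit of length
  throughout, so no walk avoiding the faults is shorter.\<close>

lemma critical_walk:
  "\<exists>n. weighted_walk (E - faults) weight n (Path False 0) (Path True 0) \<and>
     pot (Path True 0) = pot (Path False 0) + D * int n"
proof -
  have w: "0 \<le> base - 2 * sW" "0 \<le> base - 2 * tW" "0 \<le> link + dot h h" "0 < c0" "0 < D"
    using slots c0_bounds D_pos dot_self_nonneg[of h] by (simp_all add: base_def link_def)
  have hook: "(Path False sW, Hub False \<kappa> \<alpha>) \<in> E - faults" "(Path True tW, Hub True \<kappa>' \<beta>) \<in> E - faults"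
    using E.hook[OF K_a(1) \<alpha>(1), of False] E.hook[OF K_a(2) \<beta>(1), of True] not_fault_G
    by (simp_all add: sW_def tW_def)
  have h': "a - \<kappa> = h" "\<kappa>' - a = h" by (simp_all add: \<kappa>_def \<kappa>'_def)
  have z1: "z0 + scale D v = scale D \<beta> + h"
    unfolding z0_def v_def by (simp add: scale_diff[symmetric])
  have src: "(Hub False \<kappa> \<alpha>, Grid a 0 0 z0) \<in> E - faults"
    using E.source[OF K_a(1) \<alpha>(1) a] h not_fault_G unfolding h' by (simp add: z0_def)
  have trg: "(Hub True \<kappa>' \<beta>, Grid a 0 D (z0 + scale D v)) \<in> E - faults"
    using E.target[OF K_a(2) \<beta>(1) a] h not_fault_G unfolding h' z1 by simp
  have d: "dot (a - \<kappa>') (a - \<kappa>') = dot h h"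
    by (simp add: \<kappa>'_def)
  note W = weighted_walk_trans
  have "weighted_walk (E - faults) weight (nat sW + nat (base - 2 * sW) + nat (link + dot h h)
      + nat c0 + nat D + nat (link + dot h h) + nat (base - 2 * tW) + nat tW) (Path False 0) (Path True 0)"
  proof (intro W)
    show "weighted_walk (E - faults) weight (nat sW) (Path False 0) (Path False sW)"
      using path_walk[of "nat sW" False] slots by simp
    show "weighted_walk (E - faults) weight (nat (base - 2 * sW)) (Path False sW) (Hub False \<kappa> \<alpha>)"
      using weighted_walk_edge[OF hook(1), of weight] by simp
    show "weighted_walk (E - faults) weight (nat (link + dot h h)) (Hub False \<kappa> \<alpha>) (Grid a 0 0 z0)"
      using weighted_walk_edge[OF src, of weight] by (simp add: h')
    show "weighted_walk (E - faults) weight (nat c0) (Grid a 0 0 z0) (Grid a c0 0 z0)"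
      using bus_walk[of "nat c0"] w by simp
    show "weighted_walk (E - faults) weight (nat D) (Grid a c0 0 z0) (Grid a 0 D (z0 + scale D v))"
      using grid_walk[of "nat D"] w by simp
    show "weighted_walk (E - faults) weight (nat (link + dot h h)) (Grid a 0 D (z0 + scale D v)) (Hub True \<kappa>' \<beta>)"
      using weighted_walk_edge_rev[OF trg, of weight] by (simp add: d)
    show "weighted_walk (E - faults) weight (nat (base - 2 * tW)) (Hub True \<kappa>' \<beta>) (Path True tW)"
      using weighted_walk_edge_rev[OF hook(2), of weight] by simp
    show "weighted_walk (E - faults) weight (nat tW) (Path True tW) (Path True 0)"
      using weighted_walk_sym[OF path_walk[of "nat tW" True]] slots by simp
  qed
  moreover have "pot (Path True 0) = pot (Path False 0) + D * int (nat sW + nat (base - 2 * sW) +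
      nat (link + dot h h) + nat c0 + nat D + nat (link + dot h h) + nat (base - 2 * tW) + nat tW)"
    using w slots by (simp add: Y_def sX_def tX_def algebra_simps)
  ultimately show ?thesis by blast
qed

lemma forced_critical:
  "forced_edge (subdivide V E weight) (Orig (Path False 0)) (Orig (Path True 0)) (unit_edge critical)"
proof -
  obtain n where n: "weighted_walk (E - faults) weight n (Path False 0) (Path True 0)"
    "pot (Path True 0) = pot (Path False 0) + D * int n"
    using critical_walk by blast
  show ?thesis
  proof (rule forced_unit_edge[where \<Psi> = pot and N = D and R = "Collect reached" and F = faults, OF _ _ _ _ _ _ _ _ _ _ _ _ n])
    show "Path False 0 \<in> V" using slots by (force simp: V_def)
    show "Path False 0 \<in> Collect reached" using slots by simp
  qed (use D_pos faults_props critical_in_E certificate in auto)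
qed

end

section \<open>Counting\<close>

lemma card_box3: "card (box3 a b c) = nat a * (nat b * nat c)"
  by (simp add: box3_def card_cartesian_product)

section \<open>The family of forced edges\<close>

context construction
begin

definition targets :: "(v3 \<times> v3 \<times> v3 \<times> v3 \<times> int) set" where
  "targets = box3 D D D \<times> box3 D D D \<times> ({0..<m\<^sup>2} \<times> {0..<m} \<times> {0..<m}) \<times>
     ({m\<^sup>2..<2 * m\<^sup>2} \<times> {0..<m} \<times> {0..<m}) \<times> {0..<D}"

definition critical_edge :: "v3 \<times> v3 \<times> v3 \<times> v3 \<times> int \<Rightarrow> node \<times> node" where
  "critical_edge = (\<lambda>(a, h, \<alpha>, \<beta>, k). target.critical m a h \<alpha> \<beta> k)"

lemma targets_target:
  "(a, h, \<alpha>, \<beta>, k) \<in> targets \<Longrightarrow> target m idx jdx a h \<alpha> \<beta> k"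
  using m_pos
  by unfold_locales (auto simp: targets_def A_def box3_def)

text \<open>The two nodes give \<open>a\<close>, \<open>k\<close> and, as a difference, the
  direction. Going back \<open>k\<close> steps yields \<open>z0\<close>, which splits uniquely into
  \<alpha> and \<open>h\<close>; then \<beta> is \<alpha> plus the direction.\<close>

lemma inj_critical_edge: "inj_on critical_edge targets"
proof (rule inj_onI)
  fix p p' assume *: "p \<in> targets" "p' \<in> targets" "critical_edge p = critical_edge p'"
  obtain a h \<alpha> \<beta> k where p: "p = (a, h, \<alpha>, \<beta>, k)" by (cases p)
  obtain a' h' \<alpha>' \<beta>' k' where p': "p' = (a', h', \<alpha>', \<beta>', k')" by (cases p')
  interpret p: target m idx jdx a h \<alpha> \<beta> k using *(1) unfolding p by (rule targets_target)
  interpret p': target m idx jdx a' h' \<alpha>' \<beta>' k' using *(2) unfolding p' by (rule targets_target)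
  have "p.critical = p'.critical" using *(3) by (simp add: critical_edge_def p p')
  then have eq: "a = a'" "k = k'" "p.z0 + scale k p.v = p'.z0 + scale k' p'.v"
    "p.z0 + scale k p.v + p.v = p'.z0 + scale k' p'.v + p'.v"
    unfolding p.critical_def p'.critical_def prod.inject node.inject by blast+
  then have v: "p.v = p'.v" by (metis add_left_cancel)
  then have "p.z0 = p'.z0" using eq by simp
  then have "\<alpha> = \<alpha>' \<and> h = h'"
    unfolding p.z0_def p'.z0_def using p.h p'.h by (rule scale_add_box_inj)
  then show "p = p'" using eq v unfolding p p' p.v_def p'.v_def by simp
qed

lemma forced_targets:
  "p \<in> targets \<Longrightarrow> forced_edge (subdivide V E weight) (Orig (Path False 0)) (Orig (Path True 0))
     (unit_edge (critical_edge p))"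
  using target.forced_critical[OF targets_target] by (cases p) (auto simp: critical_edge_def)

lemma card_targets: "nat m ^ 22 \<le> card ((unit_edge \<circ> critical_edge) ` targets)"
proof -
  have "critical_edge p \<in> E" if "p \<in> targets" for p
    using target.critical_in_E(1)[OF targets_target] that by (cases p) (auto simp: critical_edge_def)
  then have "inj_on unit_edge (critical_edge ` targets)"
    using inj_unit_edge by (auto intro: inj_on_subset)
  then have "card ((unit_edge \<circ> critical_edge) ` targets) = card targets"
    using inj_critical_edge by (intro card_image comp_inj_on)
  moreover have "nat D = 8 * (nat m)\<^sup>2" using m_pos by (simp add: D_def nat_mult_distrib nat_power_eq)
  moreover have "nat (m\<^sup>2) = (nat m)\<^sup>2" "nat (2 * m\<^sup>2 - m\<^sup>2) = (nat m)\<^sup>2"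
    using m_pos by (simp_all add: nat_power_eq)
  \<comment> \<open>\<open>D ^ 7\<close> comes from \<open>a\<close>, \<open>h\<close> and the
    layer, \<open>m ^ 4\<close> from each of \<alpha> and \<beta>.\<close>
  ultimately have "card ((unit_edge \<circ> critical_edge) ` targets) =
    (8 * (nat m)\<^sup>2) ^ 7 * (nat m)\<^sup>2 ^ 2 * nat m ^ 4"
    unfolding targets_def card_cartesian_product card_box3 card_atLeastLessThan_int
    by (simp add: power_numeral_reduce)
  also have "\<dots> = 8 ^ 7 * nat m ^ 22"
    by (simp add: power_mult_distrib flip: power_mult power_add)
  finally show ?thesis by simp
qed

section \<open>Number of vertices\<close>

lemma card_K: "card K = 27 * nat D ^ 3"
  using D_pos by (simp add: K_def card_cartesian_product nat_mult_distrib power3_eq_cube)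

lemma card_A: "card A = 2 * nat m ^ 4"
  using m_pos by (simp add: A_def card_box3 nat_mult_distrib nat_power_eq power2_eq_square power4_eq_xxxx)

lemma card_Z: "card Z = 2 * nat D ^ 3 * nat m ^ 4"
  using m_pos D_pos
  by (simp add: Z_def card_box3 nat_mult_distrib nat_power_eq power2_eq_square power4_eq_xxxx power3_eq_cube)

lemma finite_KAZ: "finite K" "finite A" "finite Z" "finite (box3 D D D)"
  by (simp_all add: K_def A_def Z_def box3_def)

definition hook_mids :: "node subdiv set" where
  "hook_mids = (\<lambda>(b, \<kappa>, \<alpha>, i). Mid (Path b (slot \<kappa> \<alpha>)) (Hub b \<kappa> \<alpha>) i) ` (UNIV \<times> K \<times> A \<times> {..<nat base})"

definition link_mids :: "node subdiv set" where
  "link_mids = (\<lambda>(b, \<kappa>, \<alpha>, a, i). Mid (Hub b \<kappa> \<alpha>)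
     (Grid a 0 (if b then D else 0) (scale D \<alpha> + (if b then \<kappa> - a else a - \<kappa>))) i) `
     (UNIV \<times> K \<times> A \<times> box3 D D D \<times> {..<nat (23 * D\<^sup>2)})"

text \<open>Only hooks and links weigh more than 1; their weights are at most \<open>base\<close>
  and \<open>link + 3 * D\<^sup>2 = 23 * D\<^sup>2\<close>.\<close>

lemma mids: "{Mid x y i | x y i. (x, y) \<in> E \<and> 0 < i \<and> i < weight x y} \<subseteq> hook_mids \<union> link_mids"
proof safe
  fix x y i assume "(x, y) \<in> E" "0 < i" "i < weight x y" "Mid x y i \<notin> link_mids"
  then show "Mid x y i \<in> hook_mids"
  proof cases
    case (hook \<kappa> \<alpha> b)
    then have "i < nat base"
      using slot_bounds(1)[OF hook(3,4)] \<open>i < weight x y\<close> by simp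
    then show ?thesis unfolding hook_mids_def using hook
      by (intro image_eqI[of _ _ "(b, \<kappa>, \<alpha>, i)"]) simp_all
  next
    case (source \<kappa> \<alpha> a)
    have "Mid x y i \<in> link_mids"
      unfolding link_mids_def using source \<open>i < weight x y\<close> dot_box_bounds(2)[OF source(6,6)]
      by (intro image_eqI[of _ _ "(False, \<kappa>, \<alpha>, a, i)"]) (simp_all add: link_def)
    then show ?thesis using \<open>Mid x y i \<notin> link_mids\<close> by simp
  next
    case (target \<kappa> \<alpha> a)
    have "dot (a - \<kappa>) (a - \<kappa>) = dot (\<kappa> - a) (\<kappa> - a)" by (simp add: dot_simps)
    then have "Mid x y i \<in> link_mids"
      unfolding link_mids_def using target \<open>i < weight x y\<close> dot_box_bounds(2)[OF target(6,6)]
      by (intro image_eqI[of _ _ "(True, \<kappa>, \<alpha>, a, i)"]) (simp_all add: link_def)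
    then show ?thesis using \<open>Mid x y i \<notin> link_mids\<close> by simp
  qed simp_all
qed

lemma card_hook_mids: "card hook_mids \<le> 139968 * (nat D ^ 8 * nat m ^ 4)"
proof -
  have "nat base = 1296 * nat D ^ 5"
    using D_pos by (simp add: base_def len_def nat_mult_distrib nat_power_eq)
  then have "card hook_mids \<le> 2 * (27 * nat D ^ 3 * (2 * nat m ^ 4 * (1296 * nat D ^ 5)))"
    unfolding hook_mids_def using finite_KAZ
    by (intro order_trans[OF card_image_le]) (simp_all add: card_cartesian_product card_K card_A)
  also have "\<dots> = 139968 * (nat D ^ (3 + 5) * nat m ^ 4)" unfolding power_add by simp
  finally show ?thesis by simp
qed

lemma card_link_mids: "card link_mids \<le> 2484 * (nat D ^ 8 * nat m ^ 4)"
proof -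
  have "nat (23 * D\<^sup>2) = 23 * nat D ^ 2"
    using D_pos by (simp add: nat_mult_distrib nat_power_eq)
  then have "card link_mids \<le> 2 * (27 * nat D ^ 3 * (2 * nat m ^ 4 * (nat D * (nat D * nat D) * (23 * nat D ^ 2))))"
    unfolding link_mids_def using finite_KAZ
    by (intro order_trans[OF card_image_le])
      (simp_all add: card_cartesian_product card_K card_A card_box3)
  also have "\<dots> = 2484 * (nat D ^ (3 + 1 + 1 + 1 + 2) * nat m ^ 4)" unfolding power_add by simp
  finally show ?thesis by simp
qed

lemma card_V: "card V \<le> 1000 * (nat D ^ 8 * nat m ^ 4)"
proof -
  define d M where "d = nat D" and "M = nat m"
  have d: "1 \<le> d" "4 * M\<^sup>2 + 1 \<le> d" "1 \<le> M" "8 * M\<^sup>2 = d"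
    using D_pos m_pos by (auto simp: d_def M_def D_def nat_mult_distrib nat_power_eq)
  have "card (\<Union>b. Path b ` {0..len}) \<le> (\<Sum>b\<in>UNIV. card (Path b ` {0..len}))"
    by (rule card_UN_le) simp
  also have "\<dots> \<le> (\<Sum>b\<in>(UNIV :: bool set). 324 * d ^ 5 + 1)"
    using D_pos
    by (intro sum_mono order_trans[OF card_image_le])
      (auto simp: len_def d_def nat_mult_distrib nat_power_eq nat_add_distrib)
  finally have 1: "card (\<Union>b. Path b ` {0..len}) \<le> 648 * d ^ 5 + 2" by simp
  have "card (\<Union>b. (\<lambda>(\<kappa>, \<alpha>). Hub b \<kappa> \<alpha>) ` (K \<times> A)) \<le> (\<Sum>b\<in>UNIV. card ((\<lambda>(\<kappa>, \<alpha>). Hub b \<kappa> \<alpha>) ` (K \<times> A)))"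
    by (rule card_UN_le) simp
  also have "\<dots> \<le> (\<Sum>b\<in>(UNIV :: bool set). 27 * d ^ 3 * (2 * M ^ 4))"
    using finite_KAZ by (intro sum_mono order_trans[OF card_image_le])
      (auto simp: card_cartesian_product card_K card_A d_def M_def)
  finally have 2: "card (\<Union>b. (\<lambda>(\<kappa>, \<alpha>). Hub b \<kappa> \<alpha>) ` (K \<times> A)) \<le> 108 * (d ^ 3 * M ^ 4)" by simp
  have "card ((\<lambda>(a, c, k, z). Grid a c k z) ` (box3 D D D \<times> {0..4 * m\<^sup>2} \<times> {0..D} \<times> Z)) \<le>
    d * (d * d) * ((4 * M\<^sup>2 + 1) * ((d + 1) * (2 * d ^ 3 * M ^ 4)))"
    using D_pos m_pos finite_KAZ by (intro order_trans[OF card_image_le])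
      (auto simp: card_cartesian_product card_box3 card_Z d_def M_def nat_add_distrib nat_mult_distrib nat_power_eq)
  also have "\<dots> \<le> d * (d * d) * (d * ((2 * d) * (2 * d ^ 3 * M ^ 4)))"
    using d by (intro mult_le_mono) auto
  also have "\<dots> = 4 * (d ^ (1 + 1 + 1 + 1 + 1 + 3) * M ^ 4)" unfolding power_add by simp
  finally have 3: "card ((\<lambda>(a, c, k, z). Grid a c k z) ` (box3 D D D \<times> {0..4 * m\<^sup>2} \<times> {0..D} \<times> Z)) \<le>
    4 * (d ^ 8 * M ^ 4)" by simp
  have 4: "d ^ 5 * 1 \<le> d ^ 8 * M ^ 4" "1 * 1 \<le> d ^ 8 * M ^ 4" "d ^ 3 * M ^ 4 \<le> d ^ 8 * M ^ 4"
    using d(1,3) by (intro mult_le_mono power_increasing one_le_power; simp)+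
  have "card V \<le> card (\<Union>b. Path b ` {0..len}) + card (\<Union>b. (\<lambda>(\<kappa>, \<alpha>). Hub b \<kappa> \<alpha>) ` (K \<times> A)) +
    card ((\<lambda>(a, c, k, z). Grid a c k z) ` (box3 D D D \<times> {0..4 * m\<^sup>2} \<times> {0..D} \<times> Z))"
    unfolding V_def by (intro order_trans[OF card_Un_le] add_mono order_refl)
  then show ?thesis using 1 2 3 4 unfolding d_def[symmetric] M_def[symmetric] by linarith
qed

lemma card_verts: "card (verts (subdivide V E weight)) \<le> 10 ^ 13 * nat m ^ 20"
proof -
  let ?mids = "{Mid x y i | x y i. (x, y) \<in> E \<and> 0 < i \<and> i < weight x y}"
  have "finite (hook_mids \<union> link_mids)"
    using finite_KAZ by (simp add: hook_mids_def link_mids_def)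
  then have "card ?mids \<le> card hook_mids + card link_mids"
    using mids card_mono card_Un_le order_trans by meson
  moreover have "card (Orig ` V) \<le> card V" using finite_V by (rule card_image_le)
  moreover have "card (verts (subdivide V E weight)) \<le> card (Orig ` V) + card ?mids"
    by (simp add: subdivide_def card_Un_le)
  \<comment> \<open>\<open>143452 = 1000 + 139968 + 2484\<close>. Substituting
    \<open>D = 8 * m\<^sup>2\<close> turns \<open>D ^ 8 * m ^ 4\<close> into
    \<open>8 ^ 8 * m ^ 20\<close>.\<close>
  ultimately have "card (verts (subdivide V E weight)) \<le> 143452 * (nat D ^ 8 * nat m ^ 4)"
    using card_V card_hook_mids card_link_mids by linarith
  also have "nat D = 8 * (nat m)\<^sup>2" using m_pos by (simp add: D_def nat_mult_distrib nat_power_eq)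
  also have "143452 * ((8 * (nat m)\<^sup>2) ^ 8 * nat m ^ 4) = 2406725189632 * nat m ^ (2 * 8 + 4)"
    unfolding power_mult_distrib power_add power_mult by simp
  finally show ?thesis by simp
qed

end

section \<open>Instantiation for every number of vertices\<close>

lemma finite_index:
  assumes "finite S" "card S \<le> n"
  obtains f :: "'a \<Rightarrow> int" where "inj_on f S" "\<And>x. x \<in> S \<Longrightarrow> 0 \<le> f x" "\<And>x. x \<in> S \<Longrightarrow> f x < int n"
proof -
  obtain g where g: "inj_on g S" "g ` S \<subseteq> {..<n}"
    using card_le_inj[of S "{..<n}"] assms by auto
  show ?thesis
    by (rule that[of "int \<circ> g"]) (use g in \<open>auto simp: inj_on_def\<close>)
qed

lemma (in parameters) construction_exists: "\<exists>i j. construction m i j"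
proof -
  obtain i :: "v3 \<Rightarrow> int" where i: "inj_on i K" "\<And>\<kappa>. \<kappa> \<in> K \<Longrightarrow> 0 \<le> i \<kappa>"
    "\<And>\<kappa>. \<kappa> \<in> K \<Longrightarrow> i \<kappa> < int (27 * nat D ^ 3)"
    by (rule finite_index[of K "27 * nat D ^ 3"])
      (use D_pos in \<open>auto simp: K_def card_cartesian_product nat_mult_distrib power3_eq_cube\<close>)
  obtain j :: "int \<times> int \<Rightarrow> int" where j: "inj_on j ({0..<m} \<times> {0..<m})"
    "\<And>p. p \<in> {0..<m} \<times> {0..<m} \<Longrightarrow> 0 \<le> j p"
    "\<And>p. p \<in> {0..<m} \<times> {0..<m} \<Longrightarrow> j p < int ((nat m)\<^sup>2)"
    by (rule finite_index[of "{0..<m} \<times> {0..<m}" "(nat m)\<^sup>2"])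
      (auto simp: card_cartesian_product power2_eq_square)
  have "int (27 * nat D ^ 3) = 27 * D ^ 3" "int ((nat m)\<^sup>2) = m\<^sup>2"
    using D_pos m_pos by auto
  with i j have "construction m i j"
    by unfold_locales auto
  then show ?thesis by blast
qed

lemma lower_bound_graph:
  assumes "1 \<le> k" "10 ^ 13 * k ^ 20 \<le> n"
  shows "\<exists>(G :: nat ugraph) s t. simple_graph G \<and> card (verts G) = n \<and> s \<in> verts G \<and> t \<in> verts G \<and>
    (\<forall>H. two_FT_preserver G s t H \<longrightarrow> k ^ 22 \<le> card (edges H))"
proof -
  have "parameters (int k)" by unfold_locales (use assms in simp)
  then obtain idx jdx where "construction (int k) idx jdx"
    using parameters.construction_exists by blast
  then interpret construction "int k" idx jdx .
  let ?G = "subdivide V E weight"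
  have "\<exists>(G' :: nat ugraph) s' t'. simple_graph G' \<and> card (verts G') = n \<and> s' \<in> verts G' \<and>
    t' \<in> verts G' \<and> (\<forall>H. two_FT_preserver G' s' t' H \<longrightarrow>
      card ((unit_edge \<circ> critical_edge) ` targets) \<le> card (edges H))"
  proof (rule forced_edge_transport)
    show "card (verts ?G) \<le> n" using card_verts assms(2) by simp
    have "Path b 0 \<in> V" for b
      unfolding V_def using D_pos by (intro UnI1 UN_I[of b] imageI) (simp_all add: len_def)
    then show "Orig (Path False 0) \<in> verts ?G" "Orig (Path True 0) \<in> verts ?G"
      by (simp_all add: subdivide_def)
  qed (use simple_subdivide forced_targets in auto)
  then obtain G' :: "nat ugraph" and s' t' where G': "simple_graph G'" "card (verts G') = n"
    "s' \<in> verts G'" "t' \<in> verts G'"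
    "\<And>H. two_FT_preserver G' s' t' H \<Longrightarrow> card ((unit_edge \<circ> critical_edge) ` targets) \<le> card (edges H)"
    by blast
  have "k ^ 22 \<le> card (edges H)" if "two_FT_preserver G' s' t' H" for H
    using G'(5)[OF that] card_targets by simp
  then show ?thesis using G' by blast
qed

theorem theorem4:
  "\<exists>(\<epsilon> :: nat \<Rightarrow> real) (m :: nat \<Rightarrow> nat).
     \<epsilon> \<in> o(\<lambda>_. 1) \<and>
     (\<lambda>n. real (m n)) \<in> \<Omega>(\<lambda>n. real n powr (11 / 10 - \<epsilon> n)) \<and>
     (\<forall>n \<ge> 1. \<exists>(G :: nat ugraph) s t.
        simple_graph G \<and> card (verts G) = n \<and> s \<in> verts G \<and> t \<in> verts G \<and>
        (\<forall>H. two_FT_preserver G s t H \<longrightarrow> m n \<le> card (edges H)))"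
proof -
  define C :: real where "C = 10 ^ 13"
  \<comment> \<open>Solves \<open>C * x ^ 20 = n\<close>, so its floor \<open>k\<close> is the
    largest size with \<open>10 ^ 13 * k ^ 20 \<le> n\<close>, and \<open>k ^ 22\<close> has order
    \<open>n\<close> to the power \<open>22 / 20 = 11 / 10\<close>.\<close>
  define x where "x n = (real n / C) powr (1 / 20)" for n :: nat
  define k where "k n = nat \<lfloor>x n\<rfloor>" for n
  have k_le: "10 ^ 13 * k n ^ 20 \<le> n" for n
  proof -
    have "real (k n) \<le> x n" by (simp add: k_def x_def)
    then have "real (k n) ^ 20 \<le> x n ^ 20" by (intro power_mono) auto
    also have "x n ^ 20 = real n / C"
      by (cases "n = 0") (simp_all add: x_def powr_power C_def)
    finally have "C * real (k n) ^ 20 \<le> real n" by (simp add: C_def field_simps)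
    then have "real (10 ^ 13 * k n ^ 20) \<le> real n" by (simp add: C_def)
    then show ?thesis by (simp only: of_nat_le_iff)
  qed
  have graphs: "\<exists>(G :: nat ugraph) s t. simple_graph G \<and> card (verts G) = n \<and> s \<in> verts G \<and> t \<in> verts G \<and>
      (\<forall>H. two_FT_preserver G s t H \<longrightarrow> k n ^ 22 \<le> card (edges H))" if "1 \<le> n" for n
  proof (cases "k n = 0")
    case True
    \<comment> \<open>For small \<open>n\<close> the bound is 0 and an edgeless graph will
      do.\<close>
    then show ?thesis using that
      by (intro exI[of _ "({..<n}, {})"] exI[of _ 0]) (simp add: simple_graph_def)
  next
    case False
    then show ?thesis using k_le by (intro lower_bound_graph) simp_all
  qed
  have "(\<lambda>n. real (k n ^ 22)) \<in> \<Omega>(\<lambda>n. real n powr (11 / 10 - 0))"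
  proof (rule landau_omega.bigI)
    show "0 < (1 / 2) ^ 22 * (1 / C) powr (11 / 10)" by (simp add: C_def)
    have "(1 / 2) ^ 22 * (1 / C) powr (11 / 10) * norm (real n powr (11 / 10 - 0)) \<le> norm (real (k n ^ 22))"
      if n: "10 ^ 13 \<le> n" for n
    proof -
      have "C \<le> real n" using n by (simp add: C_def flip: of_nat_le_iff)
      then have "1 \<le> x n" unfolding x_def by (intro ge_one_powr_ge_zero) (simp_all add: C_def)
      then have "1 \<le> \<lfloor>x n\<rfloor>" by simp
      then have "real (k n) = of_int \<lfloor>x n\<rfloor>" "1 \<le> real (k n)" unfolding k_def by simp_all
      moreover have "x n < of_int \<lfloor>x n\<rfloor> + 1" by linarith
      \<comment> \<open>As \<open>1 \<le> x n\<close>, rounding down loses at most a factor 2,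
        whence the constant \<open>(1 / 2) ^ 22\<close>.\<close>
      ultimately have "x n / 2 \<le> real (k n)" by linarith
      then have "(x n / 2) ^ 22 \<le> real (k n) ^ 22" by (intro power_mono) (simp_all add: x_def)
      moreover have "x n ^ 22 = (1 / C) powr (11 / 10) * real n powr (11 / 10)"
      proof -
        have "x n ^ 22 = (real n / C) powr (11 / 10)"
          using n unfolding x_def by (subst powr_power) (simp_all add: C_def)
        then show ?thesis by (simp add: powr_divide C_def)
      qed
      ultimately show ?thesis by (simp add: power_divide)
    qed
    then show "\<forall>\<^sub>F n in sequentially. (1 / 2) ^ 22 * (1 / C) powr (11 / 10) * norm (real n powr (11 / 10 - 0))
        \<le> norm (real (k n ^ 22))"
      by (rule eventually_sequentiallyI)
  qed
  then show ?thesis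
    using graphs by (intro exI[of _ "\<lambda>_. 0"] exI[of _ "\<lambda>n. k n ^ 22"]) auto
qed

end
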